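(* Let $\chi$ be a primitive Dirichlet character. Let $f:\mathbb{N}\to\mathbb{C}$ be a completely multiplicative function and let $S$ be a finite set of primes such that $f(p)=\chi(p)$ for every prime $p\notin S$, and $|f(p)|=1$ for every prime $p\in S$. Let $$T=\#\{p\in S:\ f(p)=1\}-\#\{p\in S:\ \chi(p)=1\},$$ and let $N=\max\{0,T\}$ if $\chi(-1)=-1$, and $N=\max\{0,T-1\}$ if $\chi(-1)=1$. Then $$\sum_{n\leq x}f(n)=\Omega\big((\log x)^{N}\big)\quad\text{as } x\to\infty.$$
   Context: A function $f$ is completely multiplicative if $f(1)=1$ and $f(nm)=f(n)f(m)$ for all positive integers $n,m$. The notation $g(x)=\Omega(h(x))$ means $\limsup_{x\to\infty}|g(x)|/|h(x)|>0$. *)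

theory Defs
  imports
    "HOL-Analysis.Analysis"
    "HOL-Computational_Algebra.Primes"
begin

text \<open>
  Arithmetic functions on the positive integers are total functions on \<^typ>\<open>nat\<close> whose value at
  \<open>0\<close> is irrelevant.
\<close>

definition completely_multiplicative :: "(nat \<Rightarrow> complex) \<Rightarrow> bool" where
  "completely_multiplicative f \<longleftrightarrow>
     f 1 = 1 \<and> (\<forall>m n. m > 0 \<longrightarrow> n > 0 \<longrightarrow> f (m * n) = f m * f n)"

text \<open>
  Dirichlet characters are functions on all of \<open>\<int>\<close>, so that \<open>chi (-1)\<close> makes sense. The principal
  character modulo \<open>q\<close> is included; for \<open>q = 1\<close> it is the constant function \<open>1\<close>.
\<close>

definition dirichlet_character :: "nat \<Rightarrow> (int \<Rightarrow> complex) \<Rightarrow> bool" where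
  "dirichlet_character q chi \<longleftrightarrow>
     q > 0 \<and>
     (\<forall>n. chi (n + int q) = chi n) \<and>
     (\<forall>m n. chi (m * n) = chi m * chi n) \<and>
     (\<forall>n. chi n \<noteq> 0 \<longleftrightarrow> coprime n (int q))"

text \<open>
  Primitive: not induced by a character modulo a proper divisor of \<open>q\<close>. The constant character
  modulo \<open>1\<close> is primitive under this definition.
\<close>

definition primitive_dirichlet_character :: "nat \<Rightarrow> (int \<Rightarrow> complex) \<Rightarrow> bool" where
  "primitive_dirichlet_character q chi \<longleftrightarrow>
     dirichlet_character q chi \<and>
     \<not> (\<exists>d \<psi>. d dvd q \<and> d < q \<and> dirichlet_character d \<psi> \<and>
            (\<forall>n. coprime n (int q) \<longrightarrow> chi n = \<psi> n))"

text \<open>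
  The Hardy--Littlewood form of the Omega notation, i.e. the negation of \<open>g = o(h)\<close>. It is weaker
  than \<open>bigomega\<close> from \<open>HOL-Library.Landau_Symbols\<close>, which is a lower bound for all large \<open>x\<close>.
\<close>

definition omega_limsup :: "(real \<Rightarrow> complex) \<Rightarrow> (real \<Rightarrow> real) \<Rightarrow> bool" where
  "omega_limsup g h \<longleftrightarrow> Limsup at_top (\<lambda>x. ereal (norm (g x) / \<bar>h x\<bar>)) > 0"

end

theory Submission
  imports Defs "HOL-Number_Theory.Residues"
begin

text \<open>
  For \<open>N = 0\<close> it is enough that \<open>f\<close> does not tend to \<open>0\<close>: \<open>\<bar>f(p\<^sup>k)\<bar> = 1\<close> for a prime \<open>p \<notin> S\<close> not
  dividing \<open>q\<close>. Let \<open>N > 0\<close>; then \<open>chi\<close> is not principal. If the partial sums were \<open>o((log x)\<^sup>N)\<close>,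
  the series \<open>F(s) = \<Sum>f(n)n\<^bsup>-s\<^esup>\<close> would converge for real \<open>s > 0\<close>, with \<open>s\<^sup>N F(s) \<rightarrow> 0\<close> as
  \<open>s \<rightarrow> 0\<close>. Multiplying a convergent series by \<open>1 - f(p)p\<^bsup>-s\<^esup>\<close> deletes the multiples of \<open>p\<close>, so
  \<open>F(s) \<Prod>(1 - f(p)p\<^bsup>-s\<^esup>) = L(s, chi) \<Prod>(1 - chi(p)p\<^bsup>-s\<^esup>)\<close>, products over \<open>p \<in> S\<close>, without any
  analytic continuation. Each factor with \<open>f(p) = 1\<close> or \<open>chi(p) = 1\<close> has a simple zero at \<open>s = 0\<close>, so
  the contradiction comes from the order of \<open>L(s, chi)\<close> at \<open>0\<close>: it is \<open>0\<close> for odd and \<open>1\<close> for even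
  \<open>chi\<close>. Indeed \<open>L(0, chi)\<close> and \<open>L'(0, chi)\<close> are, up to nonzero factors, \<open>\<Sum>b chi(b)\<close> and
  \<open>\<Sum>chi(b) log sin(\<pi>b/q)\<close>, and by expanding the conjugate character with Gauss sums the same two
  sums compute \<open>L(1, cnj chi)\<close>, which does not vanish.
\<close>

section \<open>Summation by parts\<close>

text \<open>The hypothesis on partial sums speaks only about s > 0, so everything happens in
  one-sided limits on the real axis. For 0 < s <= 1 the series converge in general only
  conditionally: they cannot be multiplied or rearranged freely, and every identity there comes from
  summation by parts, from deleting the multiples of a prime, or from grouping into consecutive
  blocks. Primitivity decides the order of L(s, chi) at 0: an imprimitive character carries extra
  factors 1 - \<psi>(p) p^-s, and each with \<psi>(p) = 1 would add a zero. In the proof it enters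
  through the Gauss sums, which are then a nonzero constant times the conjugate character at every
  argument, including those not coprime to q. Non-vanishing at 1 splits in two. If chi^2 is not
  principal, the 3-4-1 inequality to the right of 1 suffices. If chi is real, chi^2 brings in a pole
  that spoils this count, and a Lambert series is compared with the sum of x^(m^2) instead.\<close>

lemma sum_by_parts:
  fixes a :: "nat \<Rightarrow> complex" and w :: "nat \<Rightarrow> real"
  shows "(\<Sum>k<n. a k * of_real (w k)) =
    (\<Sum>k<n. a k) * of_real (w n) + (\<Sum>k<n. (\<Sum>j\<le>k. a j) * of_real (w k - w (Suc k)))"
proof (induction n)
  case (Suc n)
  have "(\<Sum>j\<le>n. a j) = (\<Sum>k<n. a k) + a n"
    by (simp add: lessThan_Suc_atMost [symmetric])
  then show ?case
    using Suc by (simp add: algebra_simps)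
qed simp

text \<open>Abel's inequality: after summation by parts the decrements of \<open>w\<close> are
  nonnegative and telescope to \<open>w 0 - w n\<close>, which combines with the boundary term
  \<open>B * w n\<close>.\<close>

lemma norm_sum_mult_decseq_le:
  fixes a :: "nat \<Rightarrow> complex" and w :: "nat \<Rightarrow> real"
  assumes B: "\<And>n. norm (\<Sum>k<n. a k) \<le> B" and w: "decseq w" "\<And>n. 0 \<le> w n"
  shows "norm (\<Sum>k<n. a k * of_real (w k)) \<le> B * w 0"
proof -
  have B': "norm (\<Sum>k\<le>n. a k) \<le> B" for n
    using B[of "Suc n"] by (simp add: lessThan_Suc_atMost)
  have B0: "0 \<le> B"
    using B[of 0] by simp
  have d: "w (Suc k) \<le> w k" for k
    using w(1) by (simp add: decseq_Suc_iff)
  have "norm (\<Sum>k<n. (\<Sum>j\<le>k. a j) * of_real (w k - w (Suc k))) \<le> (\<Sum>k<n. B * (w k - w (Suc k)))"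
    using d by (intro sum_norm_le) (simp only: norm_mult norm_of_real, intro mult_mono, auto simp: B' B0)
  also have "\<dots> = B * (w 0 - w n)"
    by (simp add: sum_distrib_left [symmetric] sum_lessThan_telescope')
  finally have 1: "norm (\<Sum>k<n. (\<Sum>j\<le>k. a j) * of_real (w k - w (Suc k))) \<le> B * (w 0 - w n)" .
  have 2: "norm ((\<Sum>k<n. a k) * of_real (w n)) \<le> B * w n"
    using B[of n] w(2)[of n] by (simp add: norm_mult mult_right_mono)
  show ?thesis
    using norm_triangle_mono[OF 2 1] by (subst sum_by_parts) (simp add: algebra_simps)
qed

text \<open>The factor 2 arises because a partial sum started at \<open>m\<close> is a difference of
  two partial sums started at 0. The bound is uniform in \<open>n\<close> and so serves as a Cauchy
  criterion.\<close>

lemma norm_sum_tail_mult_decseq_le: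
  fixes a :: "nat \<Rightarrow> complex" and w :: "nat \<Rightarrow> real"
  assumes B: "\<And>n. norm (\<Sum>k<n. a k) \<le> B" and w: "decseq w" "\<And>n. 0 \<le> w n"
  shows "norm (\<Sum>k=m..<n. a k * of_real (w k)) \<le> 2 * B * w m"
proof (cases "m \<le> n")
  case True
  have *: "norm (\<Sum>k<i. a (k + m)) \<le> 2 * B" for i
  proof -
    have "(\<Sum>k<i. a (k + m)) = (\<Sum>k<i+m. a k) - (\<Sum>k<m. a k)"
      by (induction i) auto
    then show ?thesis
      using norm_triangle_ineq4[of "\<Sum>k<i+m. a k" "\<Sum>k<m. a k"] B[of "i+m"] B[of m] by simp
  qed
  have "(\<Sum>k=m..<n. a k * of_real (w k)) = (\<Sum>k<n-m. a (k + m) * of_real (w (k + m)))"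
    using sum.shift_bounds_nat_ivl[of "\<lambda>k. a k * of_real (w k)" 0 m "n - m"] True
    by (simp add: atLeast0LessThan)
  then show ?thesis
    using norm_sum_mult_decseq_le[OF *, of "\<lambda>k. w (k + m)"] w by (simp add: decseq_def)
next
  case False
  have "0 \<le> B" using B[of 0] by simp
  with False w(2)[of m] show ?thesis by simp
qed

lemma dirichlet_test:
  fixes a :: "nat \<Rightarrow> complex" and w :: "nat \<Rightarrow> real"
  assumes B: "\<And>n. norm (\<Sum>k<n. a k) \<le> B" and w: "decseq w" "w \<longlonglongrightarrow> 0"
  shows "summable (\<lambda>k. a k * of_real (w k))"
    and "norm (\<Sum>k. a k * of_real (w k)) \<le> B * w 0"
proof -
  have w0: "0 \<le> w n" for n
    using decseq_ge[OF w] .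
  show s: "summable (\<lambda>k. a k * of_real (w k))"
  proof (rule summable_Cauchy'[where g = "\<lambda>m. 2 * B * w m"])
    show "(\<lambda>m. 2 * B * w m) \<longlonglongrightarrow> 0"
      using tendsto_mult_left[OF w(2), of "2 * B"] by simp
  qed (use norm_sum_tail_mult_decseq_le[OF B w(1) w0] in auto)
  show "norm (\<Sum>k. a k * of_real (w k)) \<le> B * w 0"
    using summable_LIMSEQ[OF s, THEN tendsto_norm] norm_sum_mult_decseq_le[OF B w(1) w0]
    by (auto intro: LIMSEQ_le_const2)
qed

lemma dirichlet_test_tendsto:
  fixes a :: "nat \<Rightarrow> complex" and w :: "'t \<Rightarrow> nat \<Rightarrow> real"
  assumes B: "\<And>n. norm (\<Sum>k<n. a k) \<le> B"
    and w: "\<And>t. t \<in> X \<Longrightarrow> decseq (w t)" "\<And>t n. t \<in> X \<Longrightarrow> 0 \<le> w t n"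
      "\<And>t n. t \<in> X \<Longrightarrow> w t n \<le> W n" "W \<longlonglongrightarrow> 0"
    and v: "decseq v" "v \<longlonglongrightarrow> 0" "\<And>n. ((\<lambda>t. w t n) \<longlongrightarrow> v n) G"
    and X: "eventually (\<lambda>t. t \<in> X) G"
  shows "((\<lambda>t. \<Sum>k. a k * of_real (w t k)) \<longlongrightarrow> (\<Sum>k. a k * of_real (v k))) G"
proof (rule swap_uniform_limit'[where F = sequentially and S = X
      and f = "\<lambda>n t. \<Sum>k<n. a k * of_real (w t k)"
      and g = "\<lambda>n. \<Sum>k<n. a k * of_real (v k)"])
  show "\<forall>\<^sub>F n in sequentially. ((\<lambda>t. \<Sum>k<n. a k * of_real (w t k)) \<longlongrightarrow> (\<Sum>k<n. a k * of_real (v k))) G"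
    by (intro always_eventually allI tendsto_sum tendsto_mult tendsto_const tendsto_of_real v)
  show "(\<lambda>n. \<Sum>k<n. a k * complex_of_real (v k)) \<longlonglongrightarrow> (\<Sum>k. a k * complex_of_real (v k))"
    by (rule summable_LIMSEQ[OF dirichlet_test(1)[OF B v(1,2)]])
  have B0: "0 \<le> B" using B[of 0] by simp
  show "uniform_limit X (\<lambda>n t. \<Sum>k<n. a k * complex_of_real (w t k))
          (\<lambda>t. \<Sum>k. a k * complex_of_real (w t k)) sequentially"
  proof (rule uniform_limitI)
    fix e :: real assume e: "0 < e"
    have "(\<lambda>n. 2 * B * W n) \<longlonglongrightarrow> 0"
      using tendsto_mult_left[OF w(4), of "2 * B"] by simp
    then have "\<forall>\<^sub>F n in sequentially. 2 * B * W n < e"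
      using e order_tendstoD(2) by blast
    then show "\<forall>\<^sub>F n in sequentially. \<forall>t\<in>X. dist (\<Sum>k<n. a k * of_real (w t k)) (\<Sum>k. a k * of_real (w t k)) < e"
    proof eventually_elim
      case (elim m)
      show ?case
      proof
        fix t assume t: "t \<in> X"
        have wt0: "w t \<longlonglongrightarrow> 0"
          by (rule tendsto_sandwich[OF _ _ tendsto_const w(4)]) (use w(2,3) t in auto)
        have S: "(\<lambda>n. \<Sum>k<n. a k * of_real (w t k)) \<longlonglongrightarrow> (\<Sum>k. a k * of_real (w t k))"
          by (rule summable_LIMSEQ[OF dirichlet_test(1)[OF B w(1)[OF t] wt0]])
        have "norm ((\<Sum>k. a k * of_real (w t k)) - (\<Sum>k<m. a k * of_real (w t k))) \<le> 2 * B * w t m"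
        proof (rule LIMSEQ_le_const2)
          show "(\<lambda>n. norm ((\<Sum>k<n. a k * of_real (w t k)) - (\<Sum>k<m. a k * of_real (w t k))))
            \<longlonglongrightarrow> norm ((\<Sum>k. a k * of_real (w t k)) - (\<Sum>k<m. a k * of_real (w t k)))"
            by (intro tendsto_intros S)
          show "\<exists>N. \<forall>n\<ge>N. norm ((\<Sum>k<n. a k * of_real (w t k)) - (\<Sum>k<m. a k * of_real (w t k))) \<le> 2 * B * w t m"
          proof (intro exI allI impI)
            fix n assume "m \<le> n"
            then have "(\<Sum>k<n. a k * of_real (w t k)) - (\<Sum>k<m. a k * of_real (w t k)) = (\<Sum>k=m..<n. a k * of_real (w t k))"
              using sum_diff_nat_ivl[of 0 m n "\<lambda>k. a k * complex_of_real (w t k)"]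
              by (simp add: atLeast0LessThan)
            then show "norm ((\<Sum>k<n. a k * of_real (w t k)) - (\<Sum>k<m. a k * of_real (w t k))) \<le> 2 * B * w t m"
              using norm_sum_tail_mult_decseq_le[OF B w(1)[OF t] w(2)[OF t]] by simp
          qed
        qed
        also have "\<dots> \<le> 2 * B * W m"
          using B0 w(3)[OF t] by (intro mult_left_mono) auto
        finally show "dist (\<Sum>k<m. a k * of_real (w t k)) (\<Sum>k. a k * of_real (w t k)) < e"
          using elim by (simp add: dist_norm norm_minus_commute)
      qed
    qed
  qed
qed (use X in auto)

lemma abel_sums:
  fixes a :: "nat \<Rightarrow> complex" and w :: "nat \<Rightarrow> real"
  assumes "(\<lambda>n. (\<Sum>k<n. a k) * of_real (w n)) \<longlonglongrightarrow> 0"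
    and "(\<lambda>k. (\<Sum>j\<le>k. a j) * of_real (w k - w (Suc k))) sums G"
  shows "(\<lambda>k. a k * of_real (w k)) sums G"
  using tendsto_add[OF assms(1) assms(2)[unfolded sums_def]]
  by (simp add: sums_def sum_by_parts [of a w])

lemma periodic_partial_sums_bounded:
  fixes a :: "nat \<Rightarrow> complex"
  assumes q: "q > 0" and per: "\<And>n. a (n + q) = a n" and 0: "(\<Sum>k<q. a k) = 0"
  shows "(\<Sum>k<n + q. a k) = (\<Sum>k<n. a k)" "\<exists>B. \<forall>n. norm (\<Sum>k<n. a k) \<le> B"
proof -
  show A: "(\<Sum>k<n + q. a k) = (\<Sum>k<n. a k)" for n
  proof (induction n)
    case (Suc n) then show ?case using per[of n] by simp
  qed (use 0 in auto)
  have B: "norm (\<Sum>k<n. a k) \<le> (\<Sum>m<q. norm (\<Sum>k<m. a k))" for n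
  proof (induction n rule: less_induct)
    case (less n)
    show ?case
    proof (cases "n < q")
      case True then show ?thesis
        by (intro member_le_sum) auto
    next
      case False
      then show ?thesis using less[of "n - q"] A[of "n - q"] q by auto
    qed
  qed
  then show "\<exists>B. \<forall>n. norm (\<Sum>k<n. a k) \<le> B" by blast
qed

section \<open>The weights \<open>n powr - s\<close>\<close>

lemma powr_neg_decseq: "s \<ge> 0 \<Longrightarrow> decseq (\<lambda>n. real (Suc n) powr - s)"
  unfolding decseq_Suc_iff by (auto intro!: powr_mono2')

lemma powr_neg_tendsto_0: "s > 0 \<Longrightarrow> (\<lambda>n. real (Suc n) powr - s) \<longlonglongrightarrow> 0"
proof -
  assume "s > 0"
  then have "((\<lambda>x::real. x powr - s) \<longlongrightarrow> 0) at_top"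
    by (intro tendsto_neg_powr) (auto intro: filterlim_ident)
  moreover have "filterlim (\<lambda>n. real (Suc n)) at_top sequentially"
    using filterlim_compose[OF filterlim_real_sequentially filterlim_Suc] by simp
  ultimately show ?thesis
    by (rule filterlim_compose)
qed

text \<open>Mean value theorem between \<open>n + 1\<close> and \<open>n + 2\<close>. The upper
  bound at \<open>Suc n\<close> is the lower bound at \<open>n\<close>, so the differences
  themselves decrease, which a second summation by parts requires.\<close>

lemma powr_neg_diff_bounds:
  assumes s: "s > 0"
  shows "s * real (Suc (Suc n)) powr (-s - 1) \<le> real (Suc n) powr - s - real (Suc (Suc n)) powr - s"
    and "real (Suc n) powr - s - real (Suc (Suc n)) powr - s \<le> s * real (Suc n) powr (-s - 1)"
proof -
  have "\<exists>z::real. real (Suc n) < z \<and> z < real (Suc (Suc n)) \<and>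
    (real (Suc (Suc n)) powr - s - real (Suc n) powr - s) = (real (Suc (Suc n)) - real (Suc n)) * (- s * z powr (-s - 1))"
    by (rule MVT2) (auto intro!: derivative_eq_intros)
  then obtain z where z: "real (Suc n) < z" "z < real (Suc (Suc n))"
    "real (Suc n) powr - s - real (Suc (Suc n)) powr - s = s * z powr (-s - 1)"
    by (auto simp: algebra_simps)
  show "s * real (Suc (Suc n)) powr (-s - 1) \<le> real (Suc n) powr - s - real (Suc (Suc n)) powr - s"
    "real (Suc n) powr - s - real (Suc (Suc n)) powr - s \<le> s * real (Suc n) powr (-s - 1)"
    unfolding z(3) using s z(1,2) by (auto intro!: mult_left_mono powr_mono2')
qed

text \<open>Comparison with a telescoping series. The value 1 + 1/s bounds zeta(1 + s), so the pole
  of zeta counts as one factor 1/s in the 3-4-1 argument.\<close>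

lemma summable_powr_neg:
  assumes s: "s > 0"
  shows "summable (\<lambda>n. real (Suc n) powr (-s - 1))"
    and "(\<Sum>n. real (Suc n) powr (-s - 1)) \<le> 1 + 1 / s"
proof -
  have t: "(\<lambda>n. real (Suc n) powr - s - real (Suc (Suc n)) powr - s) sums (1 - 0)"
    using telescope_sums'[OF powr_neg_tendsto_0[OF s]] by simp
  have le: "real (Suc (Suc n)) powr (-s - 1) \<le> (1 / s) * (real (Suc n) powr - s - real (Suc (Suc n)) powr - s)" for n
    using powr_neg_diff_bounds(1)[OF s, of n] s by (simp add: field_simps)
  have S1: "summable (\<lambda>n. real (Suc (Suc n)) powr (-s - 1))"
    by (rule summable_comparison_test'[where N = 0, OF summable_mult[OF sums_summable[OF t], of "1 / s"]])
      (use le in auto)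
  then show S: "summable (\<lambda>n. real (Suc n) powr (-s - 1))"
    using summable_Suc_iff[of "\<lambda>n. real (Suc n) powr (-s - 1)"] by simp
  have "(\<Sum>n. real (Suc (Suc n)) powr (-s - 1)) \<le> (\<Sum>n. (1 / s) * (real (Suc n) powr - s - real (Suc (Suc n)) powr - s))"
    by (rule suminf_le[OF le S1 summable_mult[OF sums_summable[OF t]]])
  also have "\<dots> = 1 / s"
    by (subst sums_unique[OF sums_mult[OF t], symmetric]) simp
  finally show "(\<Sum>n. real (Suc n) powr (-s - 1)) \<le> 1 + 1 / s"
    using suminf_split_head[OF S] by simp
qed

section \<open>Dirichlet characters and Gauss sums\<close>

lemma dirichlet_character_1:
  assumes "dirichlet_character q chi"
  shows "chi 1 = 1"
proof -
  have "chi (1 * 1) = chi 1 * chi 1" "chi 1 \<noteq> 0"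
    using assms unfolding dirichlet_character_def by (blast, simp)
  then show ?thesis by simp
qed

lemma periodic_int_cong:
  fixes F :: "int \<Rightarrow> 'a"
  assumes per: "\<And>n. F (n + int q) = F n" and mn: "[m = n] (mod int q)"
  shows "F m = F n"
proof -
  have 1: "F (n + int q * int k) = F n" for n k
  proof (induction k)
    case (Suc k)
    then show ?case using per[of "n + int q * int k"] by (simp add: algebra_simps)
  qed simp
  obtain k where k: "m = n + int q * k"
    using cong_sym[OF mn] unfolding cong_iff_lin by blast
  show ?thesis
  proof (cases "k \<ge> 0")
    case True then show ?thesis using 1[of n "nat k"] k by simp
  next
    case False then show ?thesis using 1[of m "nat (-k)"] k by (simp add: algebra_simps)
  qed
qed

lemma dirichlet_character_cong:
  assumes "dirichlet_character q chi" "[m = n] (mod int q)"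
  shows "chi m = chi n"
  by (rule periodic_int_cong[where F = chi, OF _ assms(2)])
    (use assms(1) in \<open>simp add: dirichlet_character_def\<close>)

lemma dirichlet_character_mult:
  "dirichlet_character q chi \<Longrightarrow> chi (m * n) = chi m * chi n"
  by (simp add: dirichlet_character_def)

lemma dirichlet_character_nonzero_iff:
  "dirichlet_character q chi \<Longrightarrow> chi n \<noteq> 0 \<longleftrightarrow> coprime n (int q)"
  by (simp add: dirichlet_character_def)

lemma dirichlet_character_power:
  assumes D: "dirichlet_character q chi"
  shows "chi (n ^ k) = chi n ^ k"
  by (induction k) (simp_all add: dirichlet_character_1[OF D] dirichlet_character_mult[OF D])

lemma norm_dirichlet_character:
  assumes D: "dirichlet_character q chi" and n: "coprime n (int q)"
  shows "norm (chi n) = 1"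
proof -
  have q: "q > 0" using D by (simp add: dirichlet_character_def)
  define m where "m = nat (n mod int q)"
  have im: "int m = n mod int q" using q by (simp add: m_def)
  have c: "coprime m q"
    using n q by (simp flip: coprime_int_iff add: im coprime_mod_left_iff)
  have "chi n = chi (int m)"
    by (rule dirichlet_character_cong[OF D]) (simp add: im cong_def)
  moreover have "[int m ^ totient q = 1] (mod int q)"
    using euler_theorem[OF c] by (metis cong_int_iff of_nat_1 of_nat_power)
  then have "chi (int m) ^ totient q = 1"
    using dirichlet_character_cong[OF D] dirichlet_character_1[OF D] dirichlet_character_power[OF D] by metis
  then have "norm (chi (int m)) ^ totient q = 1"
    by (metis norm_one norm_power)
  then have "norm (chi (int m)) = 1"
    using q power_eq_imp_eq_base[of "norm (chi (int m))" "totient q" 1] by simp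
  ultimately show ?thesis by simp
qed

lemma norm_dirichlet_character_le:
  assumes D: "dirichlet_character q chi"
  shows "norm (chi n) \<le> 1"
  using norm_dirichlet_character[OF D, of n] dirichlet_character_nonzero_iff[OF D, of n]
  by (cases "coprime n (int q)") auto

lemma cnj_mult_dirichlet_character:
  assumes D: "dirichlet_character q chi" and n: "coprime n (int q)"
  shows "cnj (chi n) * chi n = 1"
  using norm_dirichlet_character[OF D n] complex_norm_square[of "chi n"] by (simp add: mult.commute)

lemma dirichlet_character_cnj:
  "dirichlet_character q chi \<Longrightarrow> dirichlet_character q (\<lambda>n. cnj (chi n))"
  by (auto simp: dirichlet_character_def)

lemma dirichlet_character_square:
  "dirichlet_character q chi \<Longrightarrow> dirichlet_character q (\<lambda>n. chi n ^ 2)"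
  by (auto simp: dirichlet_character_def power_mult_distrib)

lemma dirichlet_character_minus_1:
  assumes D: "dirichlet_character q chi"
  shows "chi (-1) = 1 \<or> chi (-1) = -1"
proof -
  have "chi (-1) ^ 2 = 1"
    using dirichlet_character_power[OF D, of "-1" 2] dirichlet_character_1[OF D] by simp
  then show ?thesis by (rule power2_eq_1_iff[THEN iffD1])
qed

lemma dirichlet_character_uminus:
  assumes D: "dirichlet_character q chi"
  shows "chi (- n) = chi (-1) * chi n"
  using dirichlet_character_mult[OF D, of "-1" n] by simp

lemma sum_periodic_mult_coprime:
  fixes F :: "int \<Rightarrow> 'a :: comm_monoid_add"
  assumes q: "q > 0" and per: "\<And>n. F (n + int q) = F n" and c: "coprime c (int q)"
  shows "(\<Sum>k<q. F (c * int k)) = (\<Sum>k<q. F (int k))"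
proof -
  define h where "h k = nat ((c * int k) mod int q)" for k
  have ih: "int (h k) = (c * int k) mod int q" for k
    using q by (simp add: h_def)
  have inj: "inj_on h {..<q}"
  proof (rule inj_onI)
    fix x y assume xy: "x \<in> {..<q}" "y \<in> {..<q}" "h x = h y"
    then have "[c * int x = c * int y] (mod int q)"
      using ih[of x] ih[of y] by (simp add: cong_def)
    then have "[int x = int y] (mod int q)"
      using c by (simp add: cong_mult_lcancel)
    then show "x = y" using xy by (simp add: cong_def)
  qed
  have sub: "h ` {..<q} \<subseteq> {..<q}"
  proof
    fix y assume "y \<in> h ` {..<q}"
    then obtain x where "y = h x" by blast
    then have "int y < int q" using ih[of x] q by simp
    then show "y \<in> {..<q}" by simp
  qed
  have im: "h ` {..<q} = {..<q}"
    by (rule card_subset_eq) (use inj sub in \<open>auto simp: card_image\<close>)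
  have "(\<Sum>k<q. F (c * int k)) = (\<Sum>k<q. F (int (h k)))"
  proof (rule sum.cong[OF refl])
    fix k
    show "F (c * int k) = F (int (h k))"
      by (rule periodic_int_cong[of F, OF per]) (simp add: ih cong_def)
  qed
  also have "\<dots> = (\<Sum>k\<in>h ` {..<q}. F (int k))"
    by (simp add: sum.reindex[OF inj] o_def)
  finally show ?thesis by (simp add: im)
qed

lemma sum_dirichlet_character_eq_0:
  assumes D: "dirichlet_character q chi" and c: "coprime c (int q)" "chi c \<noteq> 1"
  shows "(\<Sum>k<q. chi (int k)) = 0"
proof -
  have "(\<Sum>k<q. chi (c * int k)) = (\<Sum>k<q. chi (int k))"
    using D by (intro sum_periodic_mult_coprime c) (auto simp: dirichlet_character_def)
  then have "chi c * (\<Sum>k<q. chi (int k)) = (\<Sum>k<q. chi (int k))"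
    by (simp add: dirichlet_character_mult[OF D] sum_distrib_left)
  with c(2) show ?thesis by simp
qed

section \<open>Primitivity and reduction to a smaller modulus\<close>

lemma ex_coprime_lift:
  fixes m :: int and d q :: nat
  assumes d: "d dvd q" and q: "q > 0" and m: "coprime m (int d)"
  obtains m' where "[m' = m] (mod int d)" "coprime m' (int q)"
proof
  \<comment> \<open>Every prime divisor of \<open>q\<close> has to divide exactly one of
    \<open>m\<close> and \<open>d * t\<close>: one that divides \<open>m\<close> avoids
    \<open>d\<close> by coprimality and \<open>t\<close> by construction, any other divides
    \<open>t\<close>.\<close>
  define t where "t = \<Prod>{p \<in> prime_factors q. \<not> int p dvd m}"
  show "[m + int d * int t = m] (mod int d)"
    by (simp add: cong_def)
  show "coprime (m + int d * int t) (int q)"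
  proof (rule ccontr)
    assume "\<not> coprime (m + int d * int t) (int q)"
    then obtain p :: int where p: "prime p" "p dvd m + int d * int t" "p dvd int q"
      using prime_divisor_exists[of "gcd (m + int d * int t) (int q)"] q by (auto simp: coprime_iff_gcd_eq_1)
    define r where "r = nat p"
    have r: "p = int r" "prime r"
      using p(1) prime_ge_0_int[of p] by (auto simp: r_def)
    have rq: "r \<in> prime_factors q"
      using p(3) r q by (simp add: prime_factors_dvd)
    have rt: "r dvd t \<longleftrightarrow> \<not> int r dvd m"
    proof
      assume "r dvd t"
      then obtain s where s: "s \<in> prime_factors q" "\<not> int s dvd m" "r dvd s"
        unfolding t_def using r(2) by (subst (asm) prime_dvd_prod_iff) auto
      then have "r = s" using r(2) primes_dvd_imp_eq by auto
      with s show "\<not> int r dvd m" by simp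
    next
      assume "\<not> int r dvd m"
      then show "r dvd t" unfolding t_def using rq by (intro dvd_prodI) auto
    qed
    show False
    proof (cases "int r dvd m")
      case True
      then have "int r dvd int d * int t"
        using p(2) r by (simp add: dvd_add_right_iff)
      then have "r dvd d" using rt True r
        by (metis int_dvd_int_iff of_nat_mult prime_dvd_mult_nat)
      then have "is_unit (int r)" using True m by (meson coprime_common_divisor int_dvd_int_iff)
      with r show False by simp
    next
      case False
      then have "int r dvd int d * int t" using rt by simp
      then have "int r dvd m" using p(2) r by (simp add: dvd_add_left_iff)
      with False show False by simp
    qed
  qed
qed

text \<open>If \<open>chi\<close> were 1 on all units congruent to 1 mod \<open>d\<close>, its
  values on units mod \<open>q\<close> would depend only on the residue mod \<open>d\<close>, and
  \<open>chi\<close> would be induced from modulus \<open>d\<close>.\<close>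

lemma primitive_imp_ex_nontrivial:
  assumes P: "primitive_dirichlet_character q chi" and d: "d dvd q" "d < q"
  obtains c where "coprime c (int q)" "[c = 1] (mod int d)" "chi c \<noteq> 1"
proof (rule ccontr)
  assume "\<not> thesis"
  with that have triv: "chi c = 1" if "coprime c (int q)" "[c = 1] (mod int d)" for c
    using \<open>coprime c (int q)\<close> \<open>[c = 1] (mod int d)\<close> by blast
  have D: "dirichlet_character q chi"
    using P by (simp add: primitive_dirichlet_character_def)
  have q: "q > 0" using D by (simp add: dirichlet_character_def)
  have dq: "int d dvd int q" using d by simp
  have d0: "d > 0" using d q by (auto intro: Nat.gr0I)
  have wd: "chi m = chi n"
    if mn: "[m = n] (mod int d)" "coprime m (int q)" "coprime n (int q)" for m n
  proof -
    obtain u where u: "[n * u = 1] (mod int q)"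
      using cong_solve_coprime_int[OF mn(3)] by auto
    then have cu: "coprime u (int q)"
      by (metis cong_imp_coprime cong_sym coprime_1_left coprime_mult_left_iff)
    have ud: "[n * u = 1] (mod int d)" using u dq by (rule cong_dvd_modulus)
    have "[m * u = 1] (mod int d)"
      using cong_mult[OF mn(1) cong_refl[of u]] ud by (rule cong_trans)
    then have "chi (m * u) = 1" "chi (n * u) = 1"
      using triv mn(2,3) cu ud by auto
    then have "chi m * chi u = chi n * chi u" "chi u \<noteq> 0"
      by (simp_all add: dirichlet_character_mult[OF D] dirichlet_character_nonzero_iff[OF D] cu)
    then show ?thesis by simp
  qed
  \<comment> \<open>A number coprime to \<open>d\<close> may share a factor with \<open>q\<close>,
    so \<psi> is read off at a congruent number that does not; by \<open>wd\<close> the choice is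
    immaterial.\<close>
  define lift where "lift m = (SOME m'. [m' = m] (mod int d) \<and> coprime m' (int q))" for m
  have lift: "[lift m = m] (mod int d)" "coprime (lift m) (int q)" if "coprime m (int d)" for m
    using ex_coprime_lift[OF d(1) q that] unfolding lift_def by (metis (mono_tags, lifting) someI_ex)+
  define \<psi> where "\<psi> m = (if coprime m (int d) then chi (lift m) else 0)" for m
  have "dirichlet_character d \<psi>"
    unfolding dirichlet_character_def
  proof (intro conjI allI)
    show "d > 0" by (fact d0)
    fix m n :: int
    have cop: "coprime (n + int d) (int d) \<longleftrightarrow> coprime n (int d)"
      by (simp add: coprime_iff_gcd_eq_1)
    show "\<psi> (n + int d) = \<psi> n"
    proof (cases "coprime n (int d)")
      case True
      then have "[lift (n + int d) = n + int d] (mod int d)" "[lift n = n] (mod int d)"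
        using lift cop by auto
      then have "[lift (n + int d) = lift n] (mod int d)" by (simp add: cong_def)
      then show ?thesis
        using True cop by (auto simp: \<psi>_def intro!: wd lift)
    qed (simp add: \<psi>_def cop)
    show "\<psi> (m * n) = \<psi> m * \<psi> n"
    proof (cases "coprime m (int d) \<and> coprime n (int d)")
      case True
      then have c: "coprime m (int d)" "coprime n (int d)" "coprime (m * n) (int d)" by auto
      have "[lift (m * n) = lift m * lift n] (mod int d)"
        using cong_mult[OF lift(1)[OF c(1)] lift(1)[OF c(2)]] lift(1)[OF c(3)]
        by (meson cong_sym cong_trans)
      then have "chi (lift (m * n)) = chi (lift m * lift n)"
        by (rule wd) (use lift c in auto)
      then show ?thesis using c by (simp add: \<psi>_def dirichlet_character_mult[OF D])
    qed (auto simp: \<psi>_def)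
    show "\<psi> n \<noteq> 0 \<longleftrightarrow> coprime n (int d)"
      using lift[of n] by (auto simp: \<psi>_def dirichlet_character_nonzero_iff[OF D])
  qed
  moreover have "chi n = \<psi> n" if "coprime n (int q)" for n
  proof -
    have c: "coprime n (int d)" using that dq by (meson coprime_divisors dvd_refl)
    show ?thesis using lift[OF c] that c by (auto simp: \<psi>_def cong_sym intro!: wd)
  qed
  ultimately show False
    using P d unfolding primitive_dirichlet_character_def by blast
qed

section \<open>Additive characters modulo \<open>q\<close> and Gauss sums\<close>

definition unit_root :: "nat \<Rightarrow> int \<Rightarrow> complex" where
  "unit_root q n = cis (2 * pi * of_int n / of_nat q)"

lemma unit_root_add: "unit_root q (m + n) = unit_root q m * unit_root q n"
  by (simp add: unit_root_def cis_mult add_divide_distrib ring_distribs)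

lemma unit_root_0 [simp]: "unit_root q 0 = 1"
  by (simp add: unit_root_def)

lemma norm_unit_root [simp]: "norm (unit_root q n) = 1"
  by (simp add: unit_root_def)

lemma unit_root_power: "unit_root q n ^ k = unit_root q (n * int k)"
  by (induction k) (simp_all add: unit_root_add ring_distribs)

lemma unit_root_eq_1_iff:
  assumes q: "q > 0"
  shows "unit_root q n = 1 \<longleftrightarrow> int q dvd n"
proof
  assume "unit_root q n = 1"
  then have "exp (\<i> * of_real (2 * pi * of_int n / of_nat q)) = 1"
    by (simp add: unit_root_def cis_conv_exp)
  then obtain k :: int where "2 * pi * of_int n / of_nat q = of_int (2 * k) * pi"
    by (auto simp: exp_eq_1)
  then have "real_of_int n = of_int (k * int q)"
    using q by (simp add: field_simps)
  then have "n = k * int q" by linarith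
  then show "int q dvd n" by simp
next
  assume "int q dvd n"
  then obtain k where k: "n = int q * k" by (auto elim: dvdE)
  show "unit_root q n = 1"
    using q by (simp add: k unit_root_def cis_conv_exp exp_eq_1 mult_ac)
qed

lemma sum_unit_root:
  assumes q: "q > 0"
  shows "(\<Sum>k<q. unit_root q (n * int k)) = (if int q dvd n then of_nat q else 0)"
proof (cases "int q dvd n")
  case True
  then show ?thesis using unit_root_eq_1_iff[OF q, of "n * int _"] by simp
next
  case False
  then have ne: "unit_root q n \<noteq> 1" using unit_root_eq_1_iff[OF q] by simp
  have "unit_root q n ^ q = 1"
    using unit_root_eq_1_iff[OF q, of "n * int q"] by (simp add: unit_root_power)
  then show ?thesis
    using False geometric_sum[OF ne, of q] by (simp add: unit_root_power)
qed

definition gauss_sum :: "nat \<Rightarrow> (int \<Rightarrow> complex) \<Rightarrow> int \<Rightarrow> complex" where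
  "gauss_sum q chi n = (\<Sum>b<q. chi (int b) * unit_root q (int b * n))"

lemma gauss_sum_reindex:
  assumes D: "dirichlet_character q chi" and c: "coprime c (int q)"
  shows "gauss_sum q chi n = chi c * gauss_sum q chi (c * n)"
proof -
  have q: "q > 0" using D by (simp add: dirichlet_character_def)
  have u: "unit_root q (int q * n) = 1" for n
    by (simp add: unit_root_eq_1_iff[OF q])
  have "(\<Sum>k<q. chi (c * int k) * unit_root q (c * int k * n)) = gauss_sum q chi n"
    unfolding gauss_sum_def
    by (rule sum_periodic_mult_coprime[where F = "\<lambda>k. chi k * unit_root q (k * n)", OF q _ c])
      (use D in \<open>auto simp: dirichlet_character_def ring_distribs unit_root_add u\<close>)
  then show ?thesis
    by (simp add: gauss_sum_def sum_distrib_left dirichlet_character_mult[OF D] mult_ac)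
qed

text \<open>For \<open>n\<close> coprime to \<open>q\<close> this is a change of variable. Otherwise
  let g = gcd(n, q); primitivity supplies c congruent to 1 mod q/g with chi(c) different from 1.
  Then c n and n agree mod q, so the Gauss sum equals chi(c) times itself and vanishes, as does
  \<open>cnj (chi n)\<close>.\<close>

lemma gauss_sum_primitive:
  assumes P: "primitive_dirichlet_character q chi"
  shows "gauss_sum q chi n = cnj (chi n) * gauss_sum q chi 1"
proof -
  have D: "dirichlet_character q chi"
    using P by (simp add: primitive_dirichlet_character_def)
  have q: "q > 0" using D by (simp add: dirichlet_character_def)
  show ?thesis
  proof (cases "coprime n (int q)")
    case True
    have "gauss_sum q chi 1 = chi n * gauss_sum q chi n"
      using gauss_sum_reindex[OF D True, of 1] by simp
    then show ?thesis
      using cnj_mult_dirichlet_character[OF D True] by (simp add: mult.assoc [symmetric])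
  next
    case False
    define g where "g = nat (gcd n (int q))"
    have g: "int g = gcd n (int q)" by (simp add: g_def)
    have gq: "g dvd q" using g by (metis gcd_dvd2 int_dvd_int_iff)
    have g1: "g > 1"
    proof -
      have "g \<noteq> 0" using gq q by auto
      moreover have "g \<noteq> 1" using False g by (auto simp: coprime_iff_gcd_eq_1)
      ultimately show ?thesis by simp
    qed
    define d where "d = q div g"
    have qd: "q = d * g" using gq by (simp add: d_def)
    have "d dvd q" "d < q" using qd q g1 by auto
    then obtain c where c: "coprime c (int q)" "[c = 1] (mod int d)" "chi c \<noteq> 1"
      using primitive_imp_ex_nontrivial[OF P] by blast
    have "int g dvd n" by (simp add: g)
    moreover have "int d dvd c - 1" using c(2) by (simp add: cong_iff_dvd_diff)
    ultimately have dv: "int q dvd (c - 1) * n"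
      by (simp add: qd mult_dvd_mono)
    have "unit_root q (int b * (c * n)) = unit_root q (int b * n)" for b
    proof -
      have "int b * (c * n) = int b * n + int b * ((c - 1) * n)" by (simp add: algebra_simps)
      then show ?thesis
        using unit_root_eq_1_iff[OF q, of "int b * ((c - 1) * n)"] dv by (simp add: unit_root_add)
    qed
    then have "gauss_sum q chi (c * n) = gauss_sum q chi n"
      by (simp add: gauss_sum_def)
    then have "gauss_sum q chi n = chi c * gauss_sum q chi n"
      using gauss_sum_reindex[OF D c(1), of n] by simp
    then have "gauss_sum q chi n = 0" using c(3) by simp
    then show ?thesis
      using False dirichlet_character_nonzero_iff[OF D, of n] by simp
  qed
qed

text \<open>Fourier inversion at the point 1: pairing the Gauss sums with
  \<open>unit_root q (- int n)\<close> recovers q chi(1) = q, whereas a vanishing Gauss sum at 1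
  would make all of them vanish.\<close>

lemma gauss_sum_1_nonzero:
  assumes P: "primitive_dirichlet_character q chi"
  shows "gauss_sum q chi 1 \<noteq> 0"
proof
  assume 0: "gauss_sum q chi 1 = 0"
  have D: "dirichlet_character q chi"
    using P by (simp add: primitive_dirichlet_character_def)
  have q: "q > 0" using D by (simp add: dirichlet_character_def)
  have "0 = (\<Sum>n<q. gauss_sum q chi (int n) * unit_root q (- int n))"
    using gauss_sum_primitive[OF P] 0 by simp
  also have "\<dots> = (\<Sum>n<q. \<Sum>b<q. chi (int b) * unit_root q ((int b - 1) * int n))"
  proof (rule sum.cong[OF refl])
    fix n
    have "unit_root q (int b * int n) * unit_root q (- int n) = unit_root q ((int b - 1) * int n)" for b
      by (simp add: unit_root_add [symmetric] algebra_simps)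
    then show "gauss_sum q chi (int n) * unit_root q (- int n)
      = (\<Sum>b<q. chi (int b) * unit_root q ((int b - 1) * int n))"
      by (simp add: gauss_sum_def sum_distrib_right mult.assoc)
  qed
  also have "\<dots> = (\<Sum>b<q. chi (int b) * (\<Sum>n<q. unit_root q ((int b - 1) * int n)))"
    by (subst sum.swap) (simp add: sum_distrib_left)
  \<comment> \<open>For \<open>q = 1\<close> the class of 1 is represented by 0, hence
    \<open>1 mod q\<close> and not 1.\<close>
  also have "\<dots> = (\<Sum>b<q. if b = 1 mod q then of_nat q else 0)"
  proof (rule sum.cong[OF refl])
    fix b assume b: "b \<in> {..<q}"
    have "int q dvd int b - 1 \<longleftrightarrow> b = 1 mod q"
    proof -
      have "int q dvd int b - 1 \<longleftrightarrow> [b = 1] (mod q)"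
        by (metis cong_iff_dvd_diff cong_int_iff of_nat_1)
      also have "\<dots> \<longleftrightarrow> b = 1 mod q" using b by (simp add: cong_def)
      finally show ?thesis .
    qed
    moreover have "chi (int b) = 1" if "b = 1 mod q"
    proof -
      have "chi (int b) = chi 1"
        using that by (intro dirichlet_character_cong[OF D]) (simp add: cong_def of_nat_mod)
      then show ?thesis by (simp add: dirichlet_character_1[OF D])
    qed
    ultimately show "chi (int b) * (\<Sum>n<q. unit_root q ((int b - 1) * int n)) = (if b = 1 mod q then of_nat q else 0)"
      by (simp add: sum_unit_root[OF q])
  qed
  also have "\<dots> = of_nat q" using q by simp
  finally show False using q by simp
qed

section \<open>Lambert series and real characters\<close>

lemma sum_divisors_mult_coprime:
  fixes c :: "nat \<Rightarrow> real"
  assumes mult: "\<And>m n. c (m * n) = c m * c n" and ab: "coprime a b" "a > 0" "b > 0"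
  shows "(\<Sum>d | d dvd a * b. c d) = (\<Sum>d | d dvd a. c d) * (\<Sum>d | d dvd b. c d)"
proof -
  have "(\<Sum>d | d dvd a. c d) * (\<Sum>d | d dvd b. c d)
    = (\<Sum>(d, e)\<in>{d. d dvd a} \<times> {e. e dvd b}. c (d * e))"
    by (simp add: sum_product sum.cartesian_product mult)
  also have "\<dots> = (\<Sum>d | d dvd a * b. c d)"
  proof (rule sum.reindex_bij_witness[where i = "\<lambda>d. (gcd d a, gcd d b)" and j = "\<lambda>(d, e). d * e"])
    fix x assume "x \<in> {d. d dvd a} \<times> {e. e dvd b}"
    then obtain d e where x: "x = (d, e)" "d dvd a" "e dvd b" by auto
    have "coprime a e" "coprime b d"
      using x ab(1) by (meson coprime_commute coprime_divisors dvd_refl)+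
    then have "gcd (d * e) a = d" "gcd (d * e) b = e"
      using gcd_mult_left_right_cancel[of a e d] gcd_mult_left_left_cancel[of b d e] x
      by (simp_all add: gcd_nat.absorb1)
    then show "(gcd (case x of (d, e) \<Rightarrow> d * e) a, gcd (case x of (d, e) \<Rightarrow> d * e) b) = x"
      by (simp add: x)
  next
    fix d assume "d \<in> {d. d dvd a * b}"
    then have d: "d dvd a * b" by simp
    then obtain e f where ef: "d = e * f" "e dvd a" "f dvd b"
      using division_decomp by blast
    have "coprime a f" "coprime b e"
      using ef ab(1) by (meson coprime_commute coprime_divisors dvd_refl)+
    then have "gcd d a = e" "gcd d b = f"
      using gcd_mult_left_right_cancel[of a f e] gcd_mult_left_left_cancel[of b e f] ef
      by (simp_all add: gcd_nat.absorb1)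
    then show "(case (gcd d a, gcd d b) of (d, e) \<Rightarrow> d * e) = d"
      by (simp add: ef(1))
  qed (auto simp: mult_dvd_mono)
  finally show ?thesis by simp
qed

text \<open>The divisor sum is geometric with ratio \<open>c p\<close>. For ratio -1 it alternates
  between 1 and 0, which is why the lower bound 1 asks for an even exponent.\<close>

lemma sum_divisors_prime_power:
  fixes c :: "nat \<Rightarrow> real"
  assumes c1: "c 1 = 1" and mult: "\<And>m n. c (m * n) = c m * c n" and val: "c p \<in> {-1, 0, 1}" and p: "prime p"
  shows "0 \<le> (\<Sum>d | d dvd p ^ k. c d)" "even k \<Longrightarrow> 1 \<le> (\<Sum>d | d dvd p ^ k. c d)"
proof -
  have pw: "c (p ^ i) = c p ^ i" for i
    using c1 mult by (induction i) auto
  have inj: "inj_on (\<lambda>i. p ^ i) {..k}"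
    using prime_gt_1_nat[OF p] by (auto intro: inj_onI)
  have "{d. d dvd p ^ k} = (\<lambda>i. p ^ i) ` {..k}"
    using divides_primepow_nat[OF p, of _ k] by auto
  then have eq: "(\<Sum>d | d dvd p ^ k. c d) = (\<Sum>i\<le>k. c p ^ i)"
    by (simp add: sum.reindex[OF inj] o_def pw)
  have "(\<Sum>i\<le>k. (-1::real) ^ i) = (if even k then 1 else 0)"
    by (induction k) auto
  moreover have "(\<Sum>i\<le>k. (0::real) ^ i) = 1"
    by (induction k) auto
  moreover have "(\<Sum>i\<le>k. (1::real) ^ i) = real k + 1"
    by (induction k) auto
  ultimately show "0 \<le> (\<Sum>d | d dvd p ^ k. c d)" "even k \<Longrightarrow> 1 \<le> (\<Sum>d | d dvd p ^ k. c d)"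
    using val unfolding eq by auto
qed

text \<open>Splitting off one full prime power at a time reduces both bounds to the geometric case.
  They say that the Lambert series of \<open>c\<close>, as a power series, dominates the sum of
  x^(m^2).\<close>

lemma sum_divisors_real_character:
  fixes c :: "nat \<Rightarrow> real"
  assumes c1: "c 1 = 1" and mult: "\<And>m n. c (m * n) = c m * c n" and val: "\<And>n. c n \<in> {-1, 0, 1}"
    and n: "n > 0"
  shows "0 \<le> (\<Sum>d | d dvd n. c d)" "1 \<le> (\<Sum>d | d dvd n ^ 2. c d)"
proof -
  have "n > 0 \<longrightarrow> 0 \<le> (\<Sum>d | d dvd n. c d) \<and> 1 \<le> (\<Sum>d | d dvd n ^ 2. c d)"
  proof (induction n rule: less_induct)
    case (less n)
    consider "n = 0" | "n = 1" | "n > 1" by linarith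
    then show ?case
    proof cases
      case 2 then show ?thesis using c1 by simp
    next
      case 3
      then obtain p where p: "prime p" "p dvd n" using prime_factor_nat[of n] by auto
      define k where "k = multiplicity p n"
      obtain m where m: "n = p ^ k * m" "\<not> p dvd m"
      proof -
        have "n \<noteq> 0" "\<not> is_unit p" using 3 p(1) by auto
        then show ?thesis
          using that unfolding k_def by (rule multiplicity_decompose')
      qed
      have m0: "m > 0" using m by (auto intro: Nat.gr0I)
      have k0: "k \<noteq> 0" using m p(2) by (auto intro: ccontr)
      then have "m < n" using m prime_gt_1_nat[OF p(1)] m0 one_less_power[of p k] by simp
      then have IH: "0 \<le> (\<Sum>d | d dvd m. c d)" "1 \<le> (\<Sum>d | d dvd m ^ 2. c d)"
        using less m0 by auto
      have cop: "coprime (p ^ i) (m ^ j)" for i j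
        using p(1) m(2) by (auto intro: prime_imp_coprime)
      have "(\<Sum>d | d dvd n. c d) = (\<Sum>d | d dvd p ^ k. c d) * (\<Sum>d | d dvd m. c d)"
        unfolding m(1) using cop[of k 1] m0 prime_gt_0_nat[OF p(1)]
        by (intro sum_divisors_mult_coprime mult) auto
      moreover have "(\<Sum>d | d dvd n ^ 2. c d) = (\<Sum>d | d dvd p ^ (2 * k). c d) * (\<Sum>d | d dvd m ^ 2. c d)"
      proof -
        have "n ^ 2 = p ^ (2 * k) * m ^ 2" by (simp add: m(1) power_mult_distrib power_mult mult.commute)
        then show ?thesis
          using cop[of "2 * k" 2] m0 prime_gt_0_nat[OF p(1)] sum_divisors_mult_coprime[of c "p ^ (2 * k)" "m ^ 2", OF mult]
          by simp
      qed
      moreover have "0 \<le> (\<Sum>d | d dvd p ^ k. c d)" "1 \<le> (\<Sum>d | d dvd p ^ (2 * k). c d)"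
        using sum_divisors_prime_power[OF c1 mult val p(1)] by auto
      ultimately show ?thesis
        using IH mult_mono[of 1 "\<Sum>d | d dvd p ^ (2 * k). c d" 1 "\<Sum>d | d dvd m ^ 2. c d"] by simp
    qed simp
  qed
  with n show "0 \<le> (\<Sum>d | d dvd n. c d)" "1 \<le> (\<Sum>d | d dvd n ^ 2. c d)" by auto
qed

text \<open>Pairs are collected by their product n j = m. The cut-off n j <= N keeps both sides
  finite, so no infinite double series has to be rearranged.\<close>

lemma sum_lambert_truncated:
  fixes c :: "nat \<Rightarrow> real"
  shows "(\<Sum>n=1..N. c n * (\<Sum>j=1..N div n. x ^ (n * j))) = (\<Sum>m=1..N. (\<Sum>d | d dvd m. c d) * x ^ m)"
proof -
  have "(\<Sum>n=1..N. c n * (\<Sum>j=1..N div n. x ^ (n * j)))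
    = (\<Sum>(n, j)\<in>(SIGMA n:{1..N}. {1..N div n}). c n * x ^ (n * j))"
    by (simp add: sum_distrib_left sum.Sigma)
  also have "\<dots> = (\<Sum>(m, d)\<in>(SIGMA m:{1..N}. {d. d dvd m}). c d * x ^ m)"
  proof (rule sum.reindex_bij_witness[where i = "\<lambda>(m, d). (d, m div d)" and j = "\<lambda>(n, j). (n * j, n)"])
    fix a assume "a \<in> (SIGMA n:{1..N}. {1..N div n})"
    then obtain n j where a: "a = (n, j)" "n \<ge> 1" "j \<ge> 1" "j \<le> N div n" by auto
    then have "n * j \<le> N" using less_eq_div_iff_mult_less_eq[of n j N] by (simp add: mult.commute)
    then show "(case a of (n, j) \<Rightarrow> (n * j, n)) \<in> (SIGMA m:{1..N}. {d. d dvd m})"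
      using a by simp
    show "(case (case a of (n, j) \<Rightarrow> (n * j, n)) of (m, d) \<Rightarrow> (d, m div d)) = a"
      using a by simp
  next
    fix b assume "b \<in> (SIGMA m:{1..N}. {d. d dvd m})"
    then obtain m d where b: "b = (m, d)" "m \<ge> 1" "m \<le> N" "d dvd m" by auto
    then have d: "d \<ge> 1" "d \<le> m" by (auto intro: Nat.gr0I dvd_imp_le simp: Suc_le_eq)
    have "m div d \<ge> 1" using d by (simp add: Suc_le_eq div_greater_zero_iff)
    then show "(case b of (m, d) \<Rightarrow> (d, m div d)) \<in> (SIGMA n:{1..N}. {1..N div n})"
      using b d by (simp add: div_le_mono)
    show "(case (case b of (m, d) \<Rightarrow> (d, m div d)) of (n, j) \<Rightarrow> (n * j, n)) = b"
      using b by simp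
  qed auto
  also have "\<dots> = (\<Sum>m=1..N. (\<Sum>d | d dvd m. c d) * x ^ m)"
    by (simp add: sum_distrib_right sum.Sigma)
  finally show ?thesis .
qed

text \<open>For each of the \<open>N\<close> values of n the discarded geometric tail starts at an
  exponent at least \<open>N\<close> and has ratio x^n <= x. For fixed \<open>x\<close> the total
  error tends to 0 with growing \<open>N\<close>.\<close>

lemma sum_lambert_error:
  fixes c :: "nat \<Rightarrow> real"
  assumes x: "0 < x" "x < 1" and c: "\<And>n. \<bar>c n\<bar> \<le> 1"
  shows "\<bar>(\<Sum>n=1..N. c n * (x ^ n / (1 - x ^ n))) - (\<Sum>n=1..N. c n * (\<Sum>j=1..N div n. x ^ (n * j)))\<bar>
    \<le> real N * x ^ N / (1 - x)"
proof -
  have 1: "\<bar>c n * (x ^ n / (1 - x ^ n)) - c n * (\<Sum>j=1..N div n. x ^ (n * j))\<bar> \<le> x ^ N / (1 - x)"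
    if n: "n \<in> {1..N}" for n
  proof -
    have xn: "x ^ n < 1" "x ^ n > 0" "x ^ n \<le> x"
      using x n power_decreasing[of 1 n x] by (auto simp: power_less_one_iff)
    define k where "k = N div n"
    have "(\<Sum>j=1..k. x ^ (n * j)) = (x ^ n - x ^ (n * Suc k)) / (1 - x ^ n)"
    proof -
      define y where "y = x ^ n"
      have "y < 1" using xn by (simp add: y_def)
      moreover have "(\<Sum>j=1..k. y ^ j) * (1 - y) = y - y ^ Suc k"
      proof (induction k)
        case (Suc k)
        have "(\<Sum>j=1..Suc k. y ^ j) * (1 - y) = (\<Sum>j=1..k. y ^ j) * (1 - y) + y ^ Suc k * (1 - y)"
          by (simp add: distrib_right)
        also have "\<dots> = y - y ^ Suc (Suc k)"
          unfolding Suc.IH by (simp add: algebra_simps)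
        finally show ?case .
      qed simp
      ultimately have "(\<Sum>j=1..k. y ^ j) = (y - y ^ Suc k) / (1 - y)"
        by (simp add: eq_divide_eq)
      then show ?thesis by (simp add: y_def power_mult power_add)
    qed
    then have "x ^ n / (1 - x ^ n) - (\<Sum>j=1..k. x ^ (n * j)) = x ^ (n * Suc k) / (1 - x ^ n)"
      by (simp add: diff_divide_distrib)
    moreover have "N \<le> n * Suc k"
      using n dividend_less_times_div[of n N] by (simp add: k_def)
    then have "x ^ (n * Suc k) \<le> x ^ N"
      using x by (intro power_decreasing) auto
    then have "x ^ (n * Suc k) / (1 - x ^ n) \<le> x ^ N / (1 - x)"
      using x xn by (intro frac_le) auto
    moreover have "0 \<le> x ^ (n * Suc k) / (1 - x ^ n)" using x xn by simp
    ultimately have "\<bar>x ^ n / (1 - x ^ n) - (\<Sum>j=1..k. x ^ (n * j))\<bar> \<le> x ^ N / (1 - x)"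
      by (simp only: abs_of_nonneg)
    then have "\<bar>c n\<bar> * \<bar>x ^ n / (1 - x ^ n) - (\<Sum>j=1..k. x ^ (n * j))\<bar> \<le> 1 * (x ^ N / (1 - x))"
      using c[of n] by (intro mult_mono) auto
    then show ?thesis by (simp add: k_def abs_mult [symmetric] right_diff_distrib)
  qed
  have "\<bar>\<Sum>n=1..N. c n * (x ^ n / (1 - x ^ n)) - c n * (\<Sum>j=1..N div n. x ^ (n * j))\<bar>
    \<le> (\<Sum>n=1..N. x ^ N / (1 - x))"
    by (rule order_trans[OF sum_abs sum_mono[OF 1]])
  then show ?thesis by (simp add: sum_subtractf)
qed

text \<open>
  Monsky's proof: if \<open>\<Sum>c(n)/n = 0\<close>, then \<open>\<Sum>c(n)x\<^sup>n/(1-x\<^sup>n)\<close> stays bounded as \<open>x \<rightarrow> 1\<close>, because the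
  differences \<open>1/(n(1-x)) - x\<^sup>n/(1-x\<^sup>n)\<close> decrease in \<open>n\<close>.
\<close>

lemma lambert_diff_decseq:
  fixes x :: real
  assumes x: "0 < x" "x < 1"
  shows "decseq (\<lambda>k. 1 / (real (Suc k) * (1 - x)) - x ^ Suc k / (1 - x ^ Suc k))"
  unfolding decseq_Suc_iff
proof
  fix k
  define n where "n = Suc k"
  define G where "G m = (\<Sum>i<m. x ^ i)" for m
  have G: "1 - x ^ m = (1 - x) * G m" for m
    unfolding G_def by (rule one_diff_power_eq)
  have Gpos: "0 < G m" if "m > 0" for m
    unfolding G_def using x that by (intro sum_pos) auto
  have rev: "(\<Sum>i<m. x ^ (m - Suc i)) = G m" for m
    unfolding G_def by (rule sum.nat_diff_reindex)
  \<comment> \<open>With the square root, the product of the opposite terms x^i and x^(m-1-i) is the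
    square of y^(m-1), so AM-GM applies to the geometric sum \<open>G\<close> in pairs and only
    integer powers occur.\<close>
  define y where "y = sqrt x"
  have y: "y > 0" "y ^ 2 = x" "y < 1" using x by (auto simp: y_def)
  have xy: "x ^ i = (y ^ i) ^ 2" for i
    by (simp add: y(2) [symmetric] power_mult [symmetric] mult.commute)
  have amgm: "real m * y ^ (m - 1) \<le> G m" for m
  proof -
    have "2 * G m = (\<Sum>i<m. x ^ i + x ^ (m - Suc i))"
      using rev[of m] by (simp add: sum.distrib G_def)
    also have "\<dots> \<ge> (\<Sum>i<m. 2 * y ^ (m - 1))"
    proof (rule sum_mono)
      fix i assume "i \<in> {..<m}"
      then have "y ^ i * y ^ (m - Suc i) = y ^ (m - 1)" by (simp add: power_add [symmetric])
      then show "2 * y ^ (m - 1) \<le> x ^ i + x ^ (m - Suc i)"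
        using sum_squares_bound[of "y ^ i" "y ^ (m - Suc i)"] unfolding xy by (simp add: mult.assoc)
    qed
    finally show ?thesis by simp
  qed
  have n: "n > 0" by (simp add: n_def)
  have 1: "real n * y ^ n \<le> G n"
  proof -
    have "y ^ n \<le> y ^ (n - 1)" using y by (intro power_decreasing) auto
    then have "real n * y ^ n \<le> real n * y ^ (n - 1)" by (intro mult_left_mono) auto
    then show ?thesis using amgm[of n] by linarith
  qed
  have 2: "real (Suc n) * y ^ n \<le> G (Suc n)" using amgm[of "Suc n"] by simp
  have "(real n * y ^ n) * (real (Suc n) * y ^ n) \<le> G n * G (Suc n)"
    using 1 2 y less_imp_le[OF Gpos[OF n]] by (intro mult_mono) auto
  then have "x ^ n * (real n * real (Suc n)) \<le> G n * G (Suc n)"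
    by (simp add: xy power2_eq_square mult_ac)
  then have 3: "x ^ n / (G n * G (Suc n)) \<le> 1 / (real n * real (Suc n))"
    using Gpos[of n] Gpos[of "Suc n"] n by (simp add: divide_le_eq le_divide_eq mult_ac pos_divide_le_eq pos_le_divide_eq)
  \<comment> \<open>This recursion collapses 1/G(n) - x/G(n+1) to 1/(G(n) G(n+1)), which the product
    of the two AM-GM estimates controls.\<close>
  have GS: "G (Suc n) = 1 + x * G n"
    using G[of "Suc n"] G[of n] x by (simp add: field_simps) (simp add: G_def lessThan_Suc_atMost [symmetric] sum.lessThan_Suc_shift sum_distrib_left mult_ac)
  have "x ^ n / (1 - x ^ n) - x ^ Suc n / (1 - x ^ Suc n) = x ^ n / (1 - x) * (1 / G n - x / G (Suc n))"
    unfolding G[of n] G[of "Suc n"] using x by (simp add: right_diff_distrib)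
  also have "1 / G n - x / G (Suc n) = 1 / (G n * G (Suc n))"
    using Gpos[of n] Gpos[of "Suc n"] n by (simp add: GS field_simps)
  also have "x ^ n / (1 - x) * (1 / (G n * G (Suc n))) = (x ^ n / (G n * G (Suc n))) / (1 - x)"
    by simp
  also have "\<dots> \<le> (1 / (real n * real (Suc n))) / (1 - x)"
    using 3 x by (intro divide_right_mono) auto
  also have "\<dots> = 1 / (real n * (1 - x)) - 1 / (real (Suc n) * (1 - x))"
  proof -
    have "1 / (real n * real (Suc n)) = 1 / real n - 1 / real (Suc n)"
      using n by (simp add: field_simps)
    then show ?thesis by (simp add: diff_divide_distrib)
  qed
  finally show "1 / (real (Suc (Suc k)) * (1 - x)) - x ^ Suc (Suc k) / (1 - x ^ Suc (Suc k))
      \<le> 1 / (real (Suc k) * (1 - x)) - x ^ Suc k / (1 - x ^ Suc k)"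
    unfolding n_def by linarith
qed

lemma lambert_diff_tendsto_0:
  fixes x :: real
  assumes x: "0 < x" "x < 1"
  shows "(\<lambda>k. 1 / (real (Suc k) * (1 - x)) - x ^ Suc k / (1 - x ^ Suc k)) \<longlonglongrightarrow> 0"
proof -
  have "(\<lambda>k. inverse (real (Suc k)) * (1 / (1 - x)) - x ^ Suc k / (1 - x ^ Suc k)) \<longlonglongrightarrow> 0 * (1 / (1 - x)) - 0 / (1 - 0)"
    using LIMSEQ_inverse_real_of_nat LIMSEQ_Suc[OF LIMSEQ_power_zero[of x]] x
    by (intro tendsto_intros) auto
  then show ?thesis by (simp add: field_simps)
qed

text \<open>If the sum were 0, the Lambert series would be at most \<open>B\<close> on all of (0,
  1). It dominates every finite sum of x^(m^2), and letting x tend to 1 these reach any given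
  size.\<close>

lemma sum_harmonic_nonzero_real_character:
  fixes c :: "nat \<Rightarrow> real"
  assumes c1: "c 1 = 1" and mult: "\<And>m n. c (m * n) = c m * c n" and val: "\<And>n. c n \<in> {-1, 0, 1}"
    and B: "\<And>n. \<bar>\<Sum>k<n. c (Suc k)\<bar> \<le> B"
  shows "\<not> (\<lambda>k. c (Suc k) / real (Suc k)) sums 0"
proof
  assume zero: "(\<lambda>k. c (Suc k) / real (Suc k)) sums 0"
  have B': "norm (\<Sum>k<n. complex_of_real (c (Suc k))) \<le> B" for n
    using B[of n] by (metis norm_of_real of_real_sum)
  have c_le: "\<bar>c n\<bar> \<le> 1" for n using val[of n] by auto
  have main: "(\<Sum>m=1..M. x ^ (m ^ 2)) \<le> B" if x: "0 < x" "x < 1" for x M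
  proof -
    define b where "b k = 1 / (real (Suc k) * (1 - x)) - x ^ Suc k / (1 - x ^ Suc k)" for k
    have b: "decseq b" "b \<longlonglongrightarrow> 0"
      using lambert_diff_decseq[OF x] lambert_diff_tendsto_0[OF x] unfolding b_def by auto
    \<comment> \<open>The first weight is 1 whatever \<open>x\<close> is, so Abel's inequality gives
      a bound independent of \<open>x\<close>.\<close>
    have b0: "b 0 = 1" using x by (simp add: b_def diff_divide_distrib [symmetric])
    have bnn: "0 \<le> b n" for n using decseq_ge[OF b] .
    have bound: "\<bar>\<Sum>k<n. c (Suc k) * b k\<bar> \<le> B" for n
    proof -
      have "norm (\<Sum>k<n. complex_of_real (c (Suc k)) * of_real (b k)) \<le> B"
        using norm_sum_mult_decseq_le[OF B' b(1) bnn, of n] b0 by simp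
      then show ?thesis
        by (metis (no_types, lifting) norm_of_real of_real_mult of_real_sum sum.cong)
    qed
    define H where "H N = (\<Sum>k<N. c (Suc k) / real (Suc k))" for N
    have H: "H \<longlonglongrightarrow> 0" using zero unfolding H_def sums_def .
    \<comment> \<open>The assumed value 0 pays off here: for fixed \<open>x\<close> the term with
      the factor 1/(1 - x), which would blow up as x -> 1, disappears as N tends to
      infinity.\<close>
    have split: "(\<Sum>n=1..N. c n * (x ^ n / (1 - x ^ n))) = H N / (1 - x) - (\<Sum>k<N. c (Suc k) * b k)" for N
    proof -
      have "(\<Sum>n=1..N. c n * (x ^ n / (1 - x ^ n))) = (\<Sum>k<N. c (Suc k) * (x ^ Suc k / (1 - x ^ Suc k)))"
        by (rule sum.reindex_bij_witness[of _ Suc "\<lambda>n. n - 1"]) auto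
      also have "\<dots> = (\<Sum>k<N. c (Suc k) / real (Suc k) / (1 - x) - c (Suc k) * b k)"
        by (rule sum.cong[OF refl]) (simp add: b_def right_diff_distrib)
      finally show ?thesis by (simp add: H_def sum_subtractf sum_divide_distrib)
    qed
    have low: "(\<Sum>m=1..M. x ^ (m ^ 2)) \<le> (\<Sum>m=1..N. (\<Sum>d | d dvd m. c d) * x ^ m)" if N: "N \<ge> M ^ 2" for N
    proof -
      have "(\<Sum>m=1..M. x ^ (m ^ 2)) \<le> (\<Sum>m=1..M. (\<Sum>d | d dvd m ^ 2. c d) * x ^ (m ^ 2))"
      proof (rule sum_mono)
        fix m assume "m \<in> {1..M}"
        then have "1 \<le> (\<Sum>d | d dvd m ^ 2. c d)"
          using sum_divisors_real_character(2)[OF c1 mult val] by simp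
        then show "x ^ (m ^ 2) \<le> (\<Sum>d | d dvd m ^ 2. c d) * x ^ (m ^ 2)"
          using x mult_right_mono[of 1 _ "x ^ (m ^ 2)"] by simp
      qed
      also have "\<dots> = (\<Sum>m\<in>(\<lambda>m. m ^ 2) ` {1..M}. (\<Sum>d | d dvd m. c d) * x ^ m)"
        by (subst sum.reindex) (auto intro!: inj_onI)
      also have "\<dots> \<le> (\<Sum>m=1..N. (\<Sum>d | d dvd m. c d) * x ^ m)"
      proof (rule sum_mono2)
        show "(\<lambda>m. m ^ 2) ` {1..M} \<subseteq> {1..N}"
        proof
          fix y assume "y \<in> (\<lambda>m. m ^ 2) ` {1..M}"
          then obtain m where m: "y = m ^ 2" "1 \<le> m" "m \<le> M" by auto
          then have "m ^ 2 \<le> M ^ 2" by (simp add: power_mono)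
          then have "m ^ 2 \<le> N" using N by (rule order_trans)
          with m show "y \<in> {1..N}" by simp
        qed
        fix m assume "m \<in> {1..N} - (\<lambda>m. m ^ 2) ` {1..M}"
        then show "0 \<le> (\<Sum>d | d dvd m. c d) * x ^ m"
          using sum_divisors_real_character(1)[OF c1 mult val, of m] x by simp
      qed simp
      finally show ?thesis .
    qed
    have "(\<Sum>m=1..M. x ^ (m ^ 2)) \<le> B + \<bar>H N\<bar> / (1 - x) + real N * x ^ N / (1 - x)" if N: "N \<ge> M ^ 2" for N
    proof -
      have "\<bar>H N / (1 - x)\<bar> = \<bar>H N\<bar> / (1 - x)" using x by simp
      then show ?thesis
        using low[OF N] sum_lambert_error[where c = c and N = N, OF x c_le] bound[of N]
        unfolding sum_lambert_truncated split abs_le_iff by linarith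
    qed
    moreover have "(\<lambda>N. B + \<bar>H N\<bar> / (1 - x) + real N * x ^ N / (1 - x)) \<longlonglongrightarrow> B + \<bar>0\<bar> / (1 - x) + 0 / (1 - x)"
      using x by (intro tendsto_intros H powser_times_n_limit_0) auto
    ultimately show ?thesis
      by (intro LIMSEQ_le_const[where X = "\<lambda>N. B + \<bar>H N\<bar> / (1 - x) + real N * x ^ N / (1 - x)"]) auto
  qed
  define M where "M = nat \<lceil>B\<rceil> + 1"
  have "((\<lambda>x::real. \<Sum>m=1..M. x ^ (m ^ 2)) \<longlongrightarrow> (\<Sum>m=1..M. 1 ^ (m ^ 2))) (at_left 1)"
    by (intro tendsto_intros)
  moreover have "\<forall>\<^sub>F x in at_left 1. (\<Sum>m=1..M. x ^ (m ^ 2)) \<le> B"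
    using eventually_at_left_field[of _ "1::real"] main by (auto intro!: exI[of _ 0])
  ultimately have "(\<Sum>m=1..M. 1 ^ (m ^ 2)) \<le> B"
    by (intro tendsto_upperbound) auto
  then have "real M \<le> B" by simp
  then show False unfolding M_def by linarith
qed

section \<open>Non-vanishing at one\<close>

lemma Re_mult_of_real: "Re (z * of_real x) = Re z * x"
  by simp

text \<open>Scaling the series by \<open>c\<close> reproduces its terms at the multiples of
  \<open>p\<close>, and subtraction deletes exactly these. Spreading a series out by zeros keeps its
  sum, so conditional convergence is enough.\<close>

lemma sums_sieve_prime:
  fixes u :: "nat \<Rightarrow> complex"
  assumes u: "u sums F" and p: "p > 0" and mult: "\<And>n. u (p * n) = c * u n"
  shows "(\<lambda>n. if p dvd n then 0 else u n) sums ((1 - c) * F)"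
proof -
  define v where "v n = (if p dvd n then u n else 0)" for n
  have "strict_mono (\<lambda>n. p * n)"
    using p by (auto simp: strict_mono_def)
  moreover have "v n = 0" if "n \<notin> range (\<lambda>n. p * n)" for n
    using that by (auto simp: v_def)
  ultimately have "(\<lambda>n. v (p * n)) sums (c * F) \<longleftrightarrow> v sums (c * F)"
    by (rule sums_mono_reindex)
  moreover have "(\<lambda>n. v (p * n)) sums (c * F)"
    using sums_mult[OF u, of c] by (simp add: v_def mult)
  ultimately have "(\<lambda>n. u n - v n) sums (F - c * F)"
    using sums_diff[OF u] by blast
  moreover have "(\<lambda>n. u n - v n) = (\<lambda>n. if p dvd n then 0 else u n)"
    by (auto simp: v_def)
  ultimately show ?thesis by (simp add: algebra_simps)
qed

lemma sums_sieve:
  fixes u :: "nat \<Rightarrow> complex"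
  assumes u: "u sums F" and S: "finite S" "\<And>p. p \<in> S \<Longrightarrow> prime p"
    and mult: "\<And>m n. u (m * n) = u m * u n"
  shows "(\<lambda>n. if \<exists>p\<in>S. p dvd n then 0 else u n) sums ((\<Prod>p\<in>S. 1 - u p) * F)"
  using S
proof (induction S rule: finite_induct)
  case empty
  then show ?case using u by simp
next
  case (insert p S)
  have p: "prime p" and S: "\<And>r. r \<in> S \<Longrightarrow> prime r" using insert by auto
  let ?v = "\<lambda>n. if \<exists>r\<in>S. r dvd n then 0 else u n"
  \<comment> \<open>Deletion of the multiples of the other primes commutes with n -> p n, since none
    of them divides \<open>p\<close>; the sieved series keeps the multiplier
    \<open>u p\<close>.\<close>
  have "?v (p * n) = u p * ?v n" for n
  proof -
    have "r dvd p * n \<longleftrightarrow> r dvd n" if "r \<in> S" for r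
    proof -
      have "\<not> r dvd p" using primes_dvd_imp_eq[OF S[OF that] p] that insert.hyps(2) by auto
      then show ?thesis using prime_dvd_mult_iff[OF S[OF that]] by simp
    qed
    then show ?thesis by (auto simp: mult)
  qed
  from sums_sieve_prime[OF insert.IH[OF S] prime_gt_0_nat[OF p] this]
  have "(\<lambda>n. if p dvd n then 0 else ?v n) sums ((1 - u p) * ((\<Prod>p\<in>S. 1 - u p) * F))" .
  moreover have "(\<lambda>n. if p dvd n then 0 else ?v n) = (\<lambda>n. if \<exists>r\<in>insert p S. r dvd n then 0 else u n)"
    by auto
  ultimately show ?case
    using insert.hyps by (simp add: mult.assoc)
qed

text \<open>Sieving by all primes up to P leaves the term at 1 and indices above P, so the error is
  a tail of \<open>w\<close>. In this form, as a product tending to 1, nothing has to be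
  inverted.\<close>

lemma euler_product_tendsto:
  fixes u :: "nat \<Rightarrow> complex"
  assumes w: "summable w" and le: "\<And>n. norm (u n) \<le> w n" and u: "u 0 = 0" "u 1 = 1"
    and mult: "\<And>m n. u (m * n) = u m * u n"
  shows "(\<lambda>P. (\<Prod>p | prime p \<and> p \<le> P. 1 - u p) * (\<Sum>n. u n)) \<longlonglongrightarrow> 1"
proof -
  have su: "summable u"
    by (rule summable_comparison_test'[OF w, where N = 0]) (use le in auto)
  have bound: "norm ((\<Prod>p | prime p \<and> p \<le> P. 1 - u p) * (\<Sum>n. u n) - 1) \<le> (\<Sum>n. w (n + Suc P))" if P: "P \<ge> 1" for P
  proof -
    define v where "v n = (if \<exists>p\<in>{p. prime p \<and> p \<le> P}. p dvd n then 0 else u n)" for n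
    have v: "v sums ((\<Prod>p | prime p \<and> p \<le> P. 1 - u p) * (\<Sum>n. u n))"
      unfolding v_def
      by (rule sums_sieve[OF summable_sums[OF su]]) (auto intro: mult)
    have v1: "v 1 = 1" using u by (auto simp: v_def)
    have v0: "v n = 0" if n: "n \<noteq> 1" "n \<le> P" for n
    proof (cases "n = 0")
      case False
      then obtain p where p: "prime p" "p dvd n" using prime_factor_nat[OF n(1)] by auto
      then have "p \<le> P" using False n dvd_imp_le[of p n] by simp
      with p show ?thesis by (auto simp: v_def)
    qed (use u in \<open>auto simp: v_def\<close>)
    have "(\<Sum>n<Suc P. v n) = (\<Sum>n\<in>{1}. v n)"
      using P v0 by (intro sum.mono_neutral_right) auto
    then have "(\<Sum>n<Suc P. v n) = 1" using v1 by simp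
    then have *: "(\<lambda>n. v (n + Suc P)) sums ((\<Prod>p | prime p \<and> p \<le> P. 1 - u p) * (\<Sum>n. u n) - 1)"
      using sums_iff_shift[of v "Suc P"] v by simp
    have sw: "summable (\<lambda>n. w (n + Suc P))" using w by (simp only: summable_iff_shift)
    have nv: "norm (v n) \<le> w n" for n
      using le[of n] order_trans[OF norm_ge_zero le[of n]] by (simp add: v_def)
    show ?thesis
      unfolding sums_unique[OF *] by (rule norm_suminf_le[OF _ sw]) (rule nv)
  qed
  have "(\<lambda>P. \<Sum>n. w (n + Suc P)) \<longlonglongrightarrow> 0"
    using LIMSEQ_Suc[OF suminf_exist_split2[OF w]] by simp
  then have "(\<lambda>P. (\<Prod>p | prime p \<and> p \<le> P. 1 - u p) * (\<Sum>n. u n) - 1) \<longlonglongrightarrow> 0"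
    by (rule Lim_null_comparison[rotated]) (use bound in \<open>auto intro!: eventually_sequentiallyI[of 1]\<close>)
  then show ?thesis by (simp add: LIM_zero_iff)
qed

text \<open>On the level of logarithms this is 3 + 4 cos t + cos 2t = 2 (1 + cos t)^2 >= 0, summed
  against x^n/n. The value z = 0 occurs at primes dividing the modulus.\<close>

lemma three_four_one_local:
  fixes x :: real and z :: complex
  assumes x: "0 \<le> x" "x < 1" and z: "norm z = 1 \<or> z = 0"
  shows "(1 - x) ^ 3 * norm (1 - z * of_real x) ^ 4 * norm (1 - z ^ 2 * of_real x) \<le> 1"
proof (cases "z = 0")
  case True
  then show ?thesis using x by (simp add: power_le_one)
next
  case False
  then have z1: "norm z = 1" using z by simp
  have *: "(\<lambda>n. - (Re (v ^ n) * x ^ n / real n)) sums ln (norm (1 - v * of_real x))"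
    and pos: "norm (1 - v * of_real x) > 0" if v: "norm v = 1" for v :: complex
  proof -
    have n: "norm (v * of_real x) < 1" using v x by (simp add: norm_mult)
    then have ne: "1 - v * of_real x \<noteq> 0" by auto
    then show "norm (1 - v * of_real x) > 0" by simp
    have "(\<lambda>n. - ((v * of_real x) ^ n) / of_nat n) sums Ln (1 - v * of_real x)"
      using Ln_series'[of "- (v * of_real x)"] n by simp
    then have "(\<lambda>n. Re (- ((v * of_real x) ^ n) / of_nat n)) sums Re (Ln (1 - v * of_real x))"
      by (rule sums_Re)
    moreover have "Re (- ((v * of_real x) ^ n) / of_nat n) = - (Re (v ^ n) * x ^ n / real n)" for n
    proof -
      have "- ((v * of_real x) ^ n) / of_nat n = v ^ n * of_real (- (x ^ n) / real n)"
        by (simp add: power_mult_distrib)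
      then show ?thesis by (simp only: Re_mult_of_real) simp
    qed
    ultimately show "(\<lambda>n. - (Re (v ^ n) * x ^ n / real n)) sums ln (norm (1 - v * of_real x))"
      by (simp only: Re_Ln[OF ne])
  qed
  have z2: "norm (z ^ 2) = 1" using z1 by (simp add: norm_power)
  define A where "A = norm (1 - 1 * of_real x :: complex)"
  define B where "B = norm (1 - z * of_real x)"
  define C where "C = norm (1 - z ^ 2 * of_real x)"
  have ABC: "A > 0" "B > 0" "C > 0"
    unfolding A_def B_def C_def by (rule pos, use z1 z2 in simp)+
  have A: "A = 1 - x"
  proof -
    have "A = norm (complex_of_real (1 - x))" by (simp add: A_def)
    then show ?thesis using x by (simp only: norm_of_real)
  qed
  have sm: "(\<lambda>n. 3 * (- (Re (1 ^ n) * x ^ n / real n)) + 4 * (- (Re (z ^ n) * x ^ n / real n)) + - (Re ((z ^ 2) ^ n) * x ^ n / real n))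
      sums (3 * ln A + 4 * ln B + ln C)"
    unfolding A_def B_def C_def
    by (intro sums_add sums_mult *) (use z1 z2 in auto)
  have le: "3 * (- (Re (1 ^ n) * x ^ n / real n)) + 4 * (- (Re (z ^ n) * x ^ n / real n)) + - (Re ((z ^ 2) ^ n) * x ^ n / real n) \<le> 0" for n
  proof -
    define w where "w = z ^ n"
    have "norm w = 1" using z1 by (simp add: w_def norm_power)
    then have "Re w ^ 2 + Im w ^ 2 = 1" by (simp add: cmod_def)
    then have "Re (w ^ 2) = 2 * Re w ^ 2 - 1" by (simp add: power2_eq_square)
    moreover have "(z ^ 2) ^ n = w ^ 2" by (simp add: w_def power_mult [symmetric] mult.commute)
    moreover have "3 * (- (1 * y / m)) + 4 * (- (r * y / m)) + - ((2 * r ^ 2 - 1) * y / m) = - (2 * (1 + r) ^ 2 * (y / m))" for r y m :: real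
      by (simp add: power2_eq_square algebra_simps add_divide_distrib diff_divide_distrib)
    ultimately have "3 * (- (Re (1 ^ n) * x ^ n / real n)) + 4 * (- (Re (z ^ n) * x ^ n / real n)) + - (Re ((z ^ 2) ^ n) * x ^ n / real n)
      = - (2 * (1 + Re w) ^ 2 * (x ^ n / real n))"
      by (simp only: w_def [symmetric] power_one one_complex.simps)
    moreover have "0 \<le> 2 * (1 + Re w) ^ 2 * (x ^ n / real n)" using x by simp
    ultimately show ?thesis by linarith
  qed
  have "3 * ln A + 4 * ln B + ln C \<le> 0"
    by (rule sums_le[OF le sm sums_zero])
  also have "3 * ln A + 4 * ln B + ln C = ln (A ^ 3 * B ^ 4 * C)"
    using ABC by (simp add: ln_mult ln_realpow)
  finally have "A ^ 3 * B ^ 4 * C \<le> 1"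
    using ABC by (simp add: ln_le_zero_iff)
  then show ?thesis by (simp add: A B_def C_def)
qed

text \<open>As \<open>0 powr - s\<close> is 0, index 0 contributes nothing. The terms can thus be
  summed from 0, where divisibility by a prime selects a subsequence n -> p n, or from 1, as
  summation by parts prefers.\<close>

definition dirichlet_term :: "(nat \<Rightarrow> complex) \<Rightarrow> real \<Rightarrow> nat \<Rightarrow> complex" where
  "dirichlet_term f s n = f n * of_real (real n powr - s)"

definition dirichlet_series :: "(nat \<Rightarrow> complex) \<Rightarrow> real \<Rightarrow> complex" where
  "dirichlet_series f s = (\<Sum>n. dirichlet_term f s (Suc n))"

lemma dirichlet_term_0 [simp]: "dirichlet_term f s 0 = 0"
  by (simp add: dirichlet_term_def)

lemma dirichlet_term_mult:
  assumes "\<And>m n. f (m * n) = f m * f n"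
  shows "dirichlet_term f s (m * n) = dirichlet_term f s m * dirichlet_term f s n"
  by (simp add: dirichlet_term_def assms powr_mult)

lemma sums_dirichlet_term_Suc_iff:
  "(\<lambda>n. dirichlet_term f s (Suc n)) sums F \<longleftrightarrow> dirichlet_term f s sums F"
  using sums_Suc_iff[of "dirichlet_term f s" F] by simp

lemma summable_dirichlet_term_bounded:
  assumes B: "\<And>n. norm (\<Sum>k<n. f (Suc k)) \<le> B" and s: "s > 0"
  shows "summable (\<lambda>n. dirichlet_term f s (Suc n))" "norm (dirichlet_series f s) \<le> B"
  using dirichlet_test[of "\<lambda>k. f (Suc k)" B "\<lambda>k. real (Suc k) powr - s", OF B powr_neg_decseq powr_neg_tendsto_0] s
  unfolding dirichlet_term_def dirichlet_series_def by simp_all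

lemma dirichlet_series_sums_abs:
  assumes f: "\<And>n. norm (f n) \<le> 1" and s: "s > 0"
  shows "summable (\<lambda>n. real n powr - (1 + s))" "dirichlet_term f (1 + s) sums dirichlet_series f (1 + s)"
    "norm (dirichlet_term f (1 + s) n) \<le> real n powr - (1 + s)" "norm (dirichlet_series f (1 + s)) \<le> 1 + 1 / s"
proof -
  have e: "- s - 1 = - (1 + s)" by simp
  have S: "summable (\<lambda>n. real (Suc n) powr - (1 + s))"
    using summable_powr_neg(1)[OF s] unfolding e .
  then show "summable (\<lambda>n. real n powr - (1 + s))"
    using summable_Suc_iff[of "\<lambda>n. real n powr - (1 + s)"] by simp
  show *: "norm (dirichlet_term f (1 + s) n) \<le> real n powr - (1 + s)" for n
    using f[of n] by (simp add: dirichlet_term_def norm_mult mult_left_le_one_le)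
  have "summable (\<lambda>n. dirichlet_term f (1 + s) (Suc n))"
    by (rule summable_comparison_test'[OF S, where N = 0]) (rule *)
  then show "dirichlet_term f (1 + s) sums dirichlet_series f (1 + s)"
    unfolding sums_dirichlet_term_Suc_iff [symmetric] dirichlet_series_def by (rule summable_sums)
  have "norm (dirichlet_series f (1 + s)) \<le> (\<Sum>n. real (Suc n) powr - (1 + s))"
    unfolding dirichlet_series_def by (rule norm_suminf_le[OF * S])
  also have "\<dots> \<le> 1 + 1 / s"
    using summable_powr_neg(2)[OF s] unfolding e .
  finally show "norm (dirichlet_series f (1 + s)) \<le> 1 + 1 / s" .
qed

text \<open>Prime by prime the local inequality makes the finite Euler factors jointly at most 1 in
  norm, while their product with the powers of the three series tends to 1; the series themselves
  must account for the 1.\<close>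

lemma three_four_one:
  fixes f :: "nat \<Rightarrow> complex"
  assumes f: "\<And>n. norm (f n) = 1 \<or> f n = 0" "f 1 = 1" "\<And>m n. f (m * n) = f m * f n" and s: "s > 0"
  shows "1 \<le> norm (dirichlet_series (\<lambda>_. 1) (1 + s)) ^ 3 * norm (dirichlet_series f (1 + s)) ^ 4
    * norm (dirichlet_series (\<lambda>n. f n ^ 2) (1 + s))"
proof -
  have E: "(\<lambda>P. (\<Prod>p | prime p \<and> p \<le> P. 1 - dirichlet_term g (1 + s) p) * dirichlet_series g (1 + s)) \<longlonglongrightarrow> 1"
    if g: "\<And>n. norm (g n) \<le> 1" "g 1 = 1" "\<And>m n. g (m * n) = g m * g n" for g
  proof -
    note D = dirichlet_series_sums_abs[where f = g, OF g(1) s]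
    show ?thesis
      unfolding sums_unique[OF D(2)]
      by (rule euler_product_tendsto[OF D(1) D(3) _ _ dirichlet_term_mult[of g, OF g(3)]])
        (use g(2) in \<open>simp_all add: dirichlet_term_def\<close>)
  qed
  have f1: "norm (f n) \<le> 1" for n using f(1)[of n] by auto
  have f2: "norm (f n ^ 2) \<le> 1" for n using f1[of n] by (simp add: norm_power power_le_one)
  define E0 where "E0 P = (\<Prod>p | prime p \<and> p \<le> P. 1 - dirichlet_term (\<lambda>_. 1) (1 + s) p)" for P :: nat
  define E1 where "E1 P = (\<Prod>p | prime p \<and> p \<le> P. 1 - dirichlet_term f (1 + s) p)" for P :: nat
  define E2 where "E2 P = (\<Prod>p | prime p \<and> p \<le> P. 1 - dirichlet_term (\<lambda>n. f n ^ 2) (1 + s) p)" for P :: nat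
  define Z where "Z = dirichlet_series (\<lambda>_. 1) (1 + s)"
  define L where "L = dirichlet_series f (1 + s)"
  define M where "M = dirichlet_series (\<lambda>n. f n ^ 2) (1 + s)"
  have lim: "(\<lambda>P. norm ((E0 P * Z) ^ 3 * (E1 P * L) ^ 4 * (E2 P * M))) \<longlonglongrightarrow> norm (1 ^ 3 * 1 ^ 4 * 1 :: complex)"
    unfolding E0_def E1_def E2_def Z_def L_def M_def
    using f by (intro tendsto_norm tendsto_mult tendsto_power E f1 f2) (auto simp: power_mult_distrib)
  have small: "norm (E0 P ^ 3 * E1 P ^ 4 * E2 P) \<le> 1" for P
  proof -
    have "norm (E0 P ^ 3 * E1 P ^ 4 * E2 P) =
      (\<Prod>p | prime p \<and> p \<le> P. norm (1 - dirichlet_term (\<lambda>_. 1) (1 + s) p) ^ 3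
        * norm (1 - dirichlet_term f (1 + s) p) ^ 4 * norm (1 - dirichlet_term (\<lambda>n. f n ^ 2) (1 + s) p))"
      by (simp add: E0_def E1_def E2_def norm_mult norm_power prod_norm [symmetric] prod_power_distrib prod.distrib)
    also have "\<dots> \<le> 1"
    proof (rule prod_le_1, safe)
      fix p assume p: "prime p" "p \<le> P"
      define x where "x = real p powr - (1 + s)"
      have x: "0 \<le> x" "x < 1"
        using prime_gt_1_nat[OF p(1)] s powr_less_mono[of "- (1 + s)" 0 "real p"] by (auto simp: x_def)
      have "norm (1 - complex_of_real x) = \<bar>1 - x\<bar>"
        by (metis norm_of_real of_real_1 of_real_diff)
      then have "norm (1 - complex_of_real x) = 1 - x" using x by simp
      then show "norm (1 - dirichlet_term (\<lambda>_. 1) (1 + s) p) ^ 3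
        * norm (1 - dirichlet_term f (1 + s) p) ^ 4 * norm (1 - dirichlet_term (\<lambda>n. f n ^ 2) (1 + s) p) \<le> 1"
        using three_four_one_local[OF x f(1)[of p]] unfolding dirichlet_term_def x_def [symmetric] by simp
    qed simp
    finally show ?thesis .
  qed
  have "norm ((E0 P * Z) ^ 3 * (E1 P * L) ^ 4 * (E2 P * M)) \<le> norm Z ^ 3 * norm L ^ 4 * norm M" for P
  proof -
    have "norm ((E0 P * Z) ^ 3 * (E1 P * L) ^ 4 * (E2 P * M))
      = norm (E0 P ^ 3 * E1 P ^ 4 * E2 P) * (norm Z ^ 3 * norm L ^ 4 * norm M)"
      by (simp add: norm_mult norm_power power_mult_distrib mult_ac)
    also have "\<dots> \<le> 1 * (norm Z ^ 3 * norm L ^ 4 * norm M)"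
      by (intro mult_right_mono small) auto
    finally show ?thesis by simp
  qed
  then show ?thesis
    using LIMSEQ_le_const2[OF lim] unfolding Z_def L_def M_def by auto
qed

text \<open>
  With \<open>P(n) = \<Sum>k<n. f(k+1)/(k+1) = O(1/n)\<close>, summation by parts against \<open>n powr -s\<close> gives \<open>O(s)\<close>.
\<close>

lemma dirichlet_series_linear_bound_at_1:
  fixes f :: "nat \<Rightarrow> complex"
  assumes B: "\<And>n. norm (\<Sum>k<n. f (Suc k)) \<le> B" and zero: "dirichlet_series f 1 = 0"
  shows "\<exists>C. \<forall>s>0. norm (dirichlet_series f (1 + s)) \<le> C * s"
proof -
  have B0: "0 \<le> B" using B[of 0] by simp
  define a where "a k = f (Suc k) * of_real (real (Suc k) powr - 1)" for k
  have "summable a"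
    using summable_dirichlet_term_bounded(1)[of f B 1, OF B] by (simp add: a_def [abs_def] dirichlet_term_def)
  moreover have "suminf a = 0"
    using zero by (simp add: dirichlet_series_def dirichlet_term_def a_def [abs_def])
  ultimately have lim: "(\<lambda>n. \<Sum>k<n. a k) \<longlonglongrightarrow> 0"
    using summable_LIMSEQ[of a] by simp
  \<comment> \<open>Since the whole series is 0, a partial sum is minus its tail, which the
    Dirichlet test bounds by the size of the first weight omitted.\<close>
  have P: "norm (\<Sum>k<n. a k) \<le> 2 * B / real (Suc n)" for n
  proof -
    have t: "norm (\<Sum>k=n..<m. a k) \<le> 2 * B * real (Suc n) powr - 1" for m
      using norm_sum_tail_mult_decseq_le[of "\<lambda>k. f (Suc k)" B "\<lambda>k. real (Suc k) powr - 1", OF B powr_neg_decseq]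
      by (simp add: a_def)
    have "(\<lambda>m. norm ((\<Sum>k<m. a k) - (\<Sum>k<n. a k))) \<longlonglongrightarrow> norm (0 - (\<Sum>k<n. a k))"
      by (intro tendsto_intros lim)
    moreover have "norm ((\<Sum>k<m. a k) - (\<Sum>k<n. a k)) \<le> 2 * B * real (Suc n) powr - 1" if "m \<ge> n" for m
    proof -
      have "(\<Sum>k<m. a k) - (\<Sum>k<n. a k) = (\<Sum>k=n..<m. a k)"
        using sum_diff_nat_ivl[of 0 n m a] that by (simp add: atLeast0LessThan)
      then show ?thesis using t[of m] by simp
    qed
    ultimately have "norm (0 - (\<Sum>k<n. a k)) \<le> 2 * B * real (Suc n) powr - 1"
      by (intro LIMSEQ_le_const2[where X = "\<lambda>m. norm ((\<Sum>k<m. a k) - (\<Sum>k<n. a k))"]) auto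
    then show ?thesis by (simp add: powr_minus_divide)
  qed
  have Sq: "summable (\<lambda>k. 1 / real (Suc k) ^ 2)"
    using inverse_power_summable[of 2, where 'a = real] summable_Suc_iff[of "\<lambda>n. inverse (real n ^ 2)"]
    by (simp add: inverse_eq_divide)
  show ?thesis
  proof (intro exI[of _ "2 * B * (\<Sum>k. 1 / real (Suc k) ^ 2)"] allI impI)
    fix s :: real assume s: "s > 0"
    define w where "w k = real (Suc k) powr - s" for k
    define t where "t k = (\<Sum>j\<le>k. a j) * of_real (w k - w (Suc k))" for k
    have tb: "norm (t k) \<le> 2 * B * s * (1 / real (Suc k) ^ 2)" for k
    proof -
      have d: "0 \<le> w k - w (Suc k)" "w k - w (Suc k) \<le> s * real (Suc k) powr (- s - 1)"
        using powr_neg_diff_bounds[OF s, of k] powr_neg_decseq[of s] s by (auto simp: w_def decseq_Suc_iff)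
      have "real (Suc k) powr (- s - 1) \<le> real (Suc k) powr - 1"
        using s by (intro powr_mono) auto
      then have "s * real (Suc k) powr (- s - 1) \<le> s * (1 / real (Suc k))"
        using s mult_left_mono[of "real (Suc k) powr (- s - 1)" "1 / real (Suc k)" s]
        by (simp add: powr_minus_divide)
      then have d2: "w k - w (Suc k) \<le> s * (1 / real (Suc k))" using d by linarith
      have "norm (\<Sum>j\<le>k. a j) \<le> 2 * B / real (Suc (Suc k))"
        using P[of "Suc k"] by (simp add: lessThan_Suc_atMost)
      also have "\<dots> \<le> 2 * B / real (Suc k)" using B0 by (intro divide_left_mono) auto
      finally have "norm (t k) \<le> (2 * B / real (Suc k)) * (s * (1 / real (Suc k)))"
        unfolding t_def norm_mult norm_of_real using d d2 B0 by (intro mult_mono) auto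
      then show ?thesis by (simp add: power2_eq_square)
    qed
    have st: "summable t"
      by (rule summable_comparison_test'[OF summable_mult[OF Sq], where N = 0]) (rule tb)
    have "(\<lambda>n. (\<Sum>k<n. a k) * of_real (w n)) \<longlonglongrightarrow> 0 * of_real 0"
      unfolding w_def by (intro tendsto_intros lim powr_neg_tendsto_0 s)
    then have "(\<lambda>k. a k * of_real (w k)) sums suminf t"
      using abel_sums[of a w "suminf t"] summable_sums[OF st] by (simp add: t_def [abs_def])
    moreover have "(\<lambda>k. a k * of_real (w k)) = (\<lambda>k. dirichlet_term f (1 + s) (Suc k))"
    proof
      fix k
      have "real (Suc k) powr - 1 * real (Suc k) powr - s = real (Suc k) powr - (1 + s)"
        unfolding powr_add [symmetric] by simp
      then show "a k * of_real (w k) = dirichlet_term f (1 + s) (Suc k)"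
        unfolding a_def w_def dirichlet_term_def mult.assoc of_real_mult [symmetric] by (simp only:)
    qed
    ultimately have "dirichlet_series f (1 + s) = suminf t"
      unfolding dirichlet_series_def by (simp add: sums_iff)
    also have "norm \<dots> \<le> (\<Sum>k. 2 * B * s * (1 / real (Suc k) ^ 2))"
      by (rule norm_suminf_le[OF tb summable_mult[OF Sq]])
    also have "\<dots> = 2 * B * s * (\<Sum>k. 1 / real (Suc k) ^ 2)"
      by (rule suminf_mult[OF Sq])
    finally show "norm (dirichlet_series f (1 + s)) \<le> 2 * B * (\<Sum>k. 1 / real (Suc k) ^ 2) * s"
      by (simp add: mult_ac)
  qed
qed

lemma dirichlet_character_partial_sums:
  assumes D: "dirichlet_character q chi" and c: "coprime c (int q)" "chi c \<noteq> 1"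
  shows "(\<Sum>k<q. chi (int (Suc k))) = 0" "\<exists>B. \<forall>n. norm (\<Sum>k<n. chi (int (Suc k))) \<le> B"
proof -
  have q: "q > 0" using D by (simp add: dirichlet_character_def)
  have per: "chi (n + int q) = chi n" for n using D by (simp add: dirichlet_character_def)
  have "(\<Sum>k<q. chi (int (Suc k))) + chi 0 = (\<Sum>k<q. chi (int k)) + chi (int q)"
    using sum.lessThan_Suc_shift[of "\<lambda>k. chi (int k)" q] by simp
  then show z: "(\<Sum>k<q. chi (int (Suc k))) = 0"
    using per[of 0] sum_dirichlet_character_eq_0[OF D c] by simp
  show "\<exists>B. \<forall>n. norm (\<Sum>k<n. chi (int (Suc k))) \<le> B"
  proof (rule periodic_partial_sums_bounded(2)[OF q _ z])
    show "chi (int (Suc (n + q))) = chi (int (Suc n))" for n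
      using per[of "int (Suc n)"] by (simp add: algebra_simps)
  qed
qed

text \<open>If chi^2 is not principal, its series at 1 + s stays bounded, and a zero of L at 1 would
  set s^4 against the s^-3 coming from zeta: a product that should be at least 1 would tend to 0. If
  chi^2 is principal, the third factor has a pole too and the count fails, but then chi takes only
  the values -1, 0, 1 and the Lambert series argument applies.\<close>

lemma dirichlet_L_1_nonzero:
  assumes D: "dirichlet_character q chi" and c: "coprime c (int q)" "chi c \<noteq> 1"
  shows "dirichlet_series (\<lambda>n. chi (int n)) 1 \<noteq> 0"
proof
  assume zero: "dirichlet_series (\<lambda>n. chi (int n)) 1 = 0"
  obtain B where B: "\<And>n. norm (\<Sum>k<n. chi (int (Suc k))) \<le> B"
    using dirichlet_character_partial_sums(2)[OF D c] by blast
  show False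
  proof (cases "\<forall>n. coprime n (int q) \<longrightarrow> chi n ^ 2 = 1")
    case True
    have val: "chi n \<in> {-1, 0, 1}" for n
      using True dirichlet_character_nonzero_iff[OF D, of n] by (auto simp: power2_eq_1_iff)
    have re: "chi n = of_real (Re (chi n))" for n using val[of n] by auto
    have "\<not> (\<lambda>k. Re (chi (int (Suc k))) / real (Suc k)) sums 0"
    proof (rule sum_harmonic_nonzero_real_character[where B = B])
      show "Re (chi (int (m * n))) = Re (chi (int m)) * Re (chi (int n))" for m n
        using val[of "int m"] val[of "int n"] by (auto simp: dirichlet_character_mult[OF D])
      show "Re (chi (int n)) \<in> {-1, 0, 1}" for n using val[of "int n"] by auto
      show "\<bar>\<Sum>k<n. Re (chi (int (Suc k)))\<bar> \<le> B" for n
        using order_trans[OF abs_Re_le_cmod B[of n]] by (simp only: Re_sum)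
    qed (simp add: dirichlet_character_1[OF D])
    moreover have "(\<lambda>k. Re (dirichlet_term (\<lambda>n. chi (int n)) 1 (Suc k))) sums Re 0"
      using summable_sums[OF summable_dirichlet_term_bounded(1)[of "\<lambda>n. chi (int n)" B 1, OF B]] zero
      unfolding dirichlet_series_def by (intro sums_Re) simp
    moreover have "Re (dirichlet_term (\<lambda>n. chi (int n)) 1 (Suc k)) = Re (chi (int (Suc k))) / real (Suc k)" for k
      by (simp only: dirichlet_term_def Re_mult_of_real) (simp add: powr_minus_divide)
    ultimately show False by simp
  next
    case False
    then obtain d where d: "coprime d (int q)" "chi d ^ 2 \<noteq> 1" by blast
    obtain B2 where B2: "\<And>n. norm (\<Sum>k<n. chi (int (Suc k)) ^ 2) \<le> B2"
      using dirichlet_character_partial_sums(2)[OF dirichlet_character_square[OF D] d] by blast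
    obtain C where C: "\<And>s. s > 0 \<Longrightarrow> norm (dirichlet_series (\<lambda>n. chi (int n)) (1 + s)) \<le> C * s"
      using dirichlet_series_linear_bound_at_1[of "\<lambda>n. chi (int n)", OF B zero] by blast
    have main: "1 \<le> (s + 1) ^ 3 * C ^ 4 * B2 * s" if s: "s > 0" for s
    proof -
      have "1 \<le> norm (dirichlet_series (\<lambda>_. 1) (1 + s)) ^ 3 * norm (dirichlet_series (\<lambda>n. chi (int n)) (1 + s)) ^ 4
        * norm (dirichlet_series (\<lambda>n. chi (int n) ^ 2) (1 + s))"
        by (rule three_four_one[OF _ _ _ s])
          (use norm_dirichlet_character[OF D] dirichlet_character_nonzero_iff[OF D] dirichlet_character_1[OF D]
             dirichlet_character_mult[OF D] in auto)
      also have "\<dots> \<le> (1 + 1 / s) ^ 3 * (C * s) ^ 4 * B2"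
        using dirichlet_series_sums_abs(4)[of "\<lambda>_. 1" s] s C[OF s]
          summable_dirichlet_term_bounded(2)[of "\<lambda>n. chi (int n) ^ 2" B2 "1 + s", OF B2]
        by (intro mult_mono power_mono mult_nonneg_nonneg) auto
      also have "\<dots> = (s + 1) ^ 3 * C ^ 4 * B2 * s"
      proof -
        have "1 + 1 / s = (s + 1) / s" using s by (simp add: field_simps)
        then show ?thesis using s by (simp add: power_divide power_mult_distrib) (simp add: field_simps eval_nat_numeral)
      qed
      finally show ?thesis .
    qed
    have "((\<lambda>s::real. (s + 1) ^ 3 * C ^ 4 * B2 * s) \<longlongrightarrow> (0 + 1) ^ 3 * C ^ 4 * B2 * 0) (at_right 0)"
      by (intro tendsto_intros)
    moreover have "\<forall>\<^sub>F s in at_right 0. 1 \<le> (s + 1) ^ 3 * C ^ 4 * B2 * s"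
      using main by (auto simp: eventually_at_right_field intro!: exI[of _ 1])
    ultimately have "1 \<le> (0 + 1) ^ 3 * C ^ 4 * B2 * (0::real)"
      by (intro tendsto_lowerbound) auto
    then show False by simp
  qed
qed

section \<open>Behaviour of Dirichlet L-functions at zero\<close>

text \<open>When the total is 0, this converts the sum of the partial sums over a period into minus
  the first moment.\<close>

lemma sum_partial_sums:
  fixes a :: "nat \<Rightarrow> complex"
  shows "(\<Sum>k<n. \<Sum>j\<le>k. a j) + (\<Sum>j<n. of_nat j * a j) = of_nat n * (\<Sum>j<n. a j)"
proof (induction n)
  case (Suc n)
  have "(\<Sum>j\<le>n. a j) = (\<Sum>j<n. a j) + a n" by (simp add: lessThan_Suc_atMost [symmetric])
  then show ?case using Suc by (simp add: algebra_simps)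
qed simp

text \<open>
  Summation by parts twice: the partial sums of a periodic mean-zero function are again periodic,
  and \<open>L(0)\<close> is their mean.
\<close>

lemma dirichlet_series_tendsto_at_0:
  fixes f :: "nat \<Rightarrow> complex"
  assumes q: "q > 0" and per: "\<And>n. f (n + q) = f n" and zero: "(\<Sum>k<q. f (Suc k)) = 0"
  shows "(dirichlet_series f \<longlongrightarrow> (\<Sum>k<q. \<Sum>j\<le>k. f (Suc j)) / of_nat q) (at_right 0)"
proof -
  define a where "a k = f (Suc k)" for k
  define \<mu> where "\<mu> = (\<Sum>k<q. \<Sum>j\<le>k. a j) / of_nat q"
  have pera: "a (n + q) = a n" for n using per[of "Suc n"] by (simp add: a_def)
  have zeroa: "(\<Sum>k<q. a k) = 0" using zero by (simp add: a_def)
  obtain B where B: "\<And>n. norm (\<Sum>k<n. a k) \<le> B"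
    using periodic_partial_sums_bounded(2)[of q a, OF q pera zeroa] by blast
  \<comment> \<open>Centring the partial sums: their constant part meets the weights
    \<open>v\<close> of total 1 and produces \<mu>, while the periodic mean-zero rest contributes at
    most \<open>B' * v 0\<close>, which tends to 0 with \<open>s\<close>.\<close>
  define X where "X k = (\<Sum>j\<le>k. a j) - \<mu>" for k
  have "X (n + q) = X n" for n
    using periodic_partial_sums_bounded(1)[of q a "Suc n", OF q pera zeroa]
    by (simp add: X_def lessThan_Suc_atMost [symmetric])
  moreover have "(\<Sum>k<q. X k) = 0"
    using q by (simp add: X_def sum_subtractf \<mu>_def)
  ultimately obtain B' where B': "\<And>n. norm (\<Sum>k<n. X k) \<le> B'"
    using periodic_partial_sums_bounded(2)[of q X] q by blast
  have main: "norm (dirichlet_series f s - \<mu>) \<le> B' * (1 - 2 powr - s)" if s: "s > 0" for s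
  proof -
    define w where "w k = real (Suc k) powr - s" for k
    define v where "v k = w k - w (Suc k)" for k
    have w0: "w \<longlonglongrightarrow> 0" unfolding w_def by (rule powr_neg_tendsto_0[OF s])
    have vs: "v sums 1"
      using telescope_sums'[OF w0] by (simp add: v_def [abs_def]) (simp add: w_def)
    have vd: "decseq v"
      unfolding decseq_Suc_iff v_def w_def
      by (rule allI, rule order_trans[OF powr_neg_diff_bounds(2)[OF s] powr_neg_diff_bounds(1)[OF s]])
    have v0: "v \<longlonglongrightarrow> 0" by (rule summable_LIMSEQ_zero[OF sums_summable[OF vs]])
    note R = dirichlet_test[OF B' vd v0]
    have "(\<lambda>k. X k * of_real (v k) + \<mu> * of_real (v k)) sums ((\<Sum>k. X k * of_real (v k)) + \<mu> * of_real 1)"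
      by (intro sums_add summable_sums R sums_mult sums_of_real vs)
    then have "(\<lambda>k. (\<Sum>j\<le>k. a j) * of_real (w k - w (Suc k))) sums ((\<Sum>k. X k * of_real (v k)) + \<mu>)"
      by (simp add: X_def v_def ring_distribs)
    moreover have "(\<lambda>n. (\<Sum>k<n. a k) * of_real (w n)) \<longlonglongrightarrow> 0"
    proof (rule Lim_null_comparison)
      show "\<forall>\<^sub>F n in sequentially. norm ((\<Sum>k<n. a k) * of_real (w n)) \<le> B * w n"
        using B by (auto simp: norm_mult w_def intro!: always_eventually mult_right_mono)
      show "(\<lambda>n. B * w n) \<longlonglongrightarrow> 0" using tendsto_mult_left[OF w0, of B] by simp
    qed
    ultimately have "(\<lambda>k. a k * of_real (w k)) sums ((\<Sum>k. X k * of_real (v k)) + \<mu>)"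
      by (rule abel_sums[rotated])
    then have "dirichlet_series f s = (\<Sum>k. X k * of_real (v k)) + \<mu>"
      unfolding dirichlet_series_def dirichlet_term_def a_def w_def by (rule sums_unique[symmetric])
    then show ?thesis using R(2) by (simp add: v_def w_def)
  qed
  have "((\<lambda>s::real. B' * (1 - 2 powr - s)) \<longlongrightarrow> B' * (1 - 2 powr - 0)) (at_right 0)"
    by (intro tendsto_intros) auto
  then have "((\<lambda>s::real. B' * (1 - 2 powr - s)) \<longlongrightarrow> 0) (at_right 0)"
    by simp
  then have "((\<lambda>s. dirichlet_series f s - \<mu>) \<longlongrightarrow> 0) (at_right 0)"
    by (rule Lim_null_comparison[rotated])
      (use main in \<open>auto simp: eventually_at_right_field intro!: exI[of _ 1]\<close>)
  then show ?thesis
    unfolding \<mu>_def a_def by (simp add: LIM_zero_iff)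
qed

text \<open>Two mean values give \<open>a * s\<close> times a difference of powers; a third, at
  \<eta>, turns this into a gap of at most \<open>2 * a\<close> times \<open>s + 1\<close>, which is
  at most 2. Hence the 4. The explicit factor \<open>s\<close> keeps the quotient by
  \<open>s\<close> bounded uniformly.\<close>

lemma powr_second_difference_bound:
  fixes x a s :: real
  assumes s: "0 < s" "s \<le> 1" and a: "0 < a" and xa: "1 \<le> x - a"
  shows "\<bar>(x + a) powr - s + (x - a) powr - s - 2 * x powr - s\<bar> \<le> 4 * a ^ 2 * s / (x - a) ^ 2"
proof -
  have D: "((\<lambda>t. t powr - r) has_real_derivative (- r * t powr (- r - 1))) (at t)" if "t > 0" for t r :: real
    using that by (auto intro!: derivative_eq_intros)
  obtain \<xi>1 where 1: "x < \<xi>1" "\<xi>1 < x + a" "(x + a) powr - s - x powr - s = (x + a - x) * (- s * \<xi>1 powr (- s - 1))"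
    using MVT2[of x "x + a" "\<lambda>t. t powr - s" "\<lambda>t. - s * t powr (- s - 1)"] D a xa by auto
  obtain \<xi>2 where 2: "x - a < \<xi>2" "\<xi>2 < x" "x powr - s - (x - a) powr - s = (x - (x - a)) * (- s * \<xi>2 powr (- s - 1))"
    using MVT2[of "x - a" x "\<lambda>t. t powr - s" "\<lambda>t. - s * t powr (- s - 1)"] D a xa by auto
  obtain \<eta> where 3: "\<xi>2 < \<eta>" "\<eta> < \<xi>1" "\<xi>1 powr - (s + 1) - \<xi>2 powr - (s + 1) = (\<xi>1 - \<xi>2) * (- (s + 1) * \<eta> powr (- (s + 1) - 1))"
    using MVT2[of \<xi>2 \<xi>1 "\<lambda>t. t powr - (s + 1)" "\<lambda>t. - (s + 1) * t powr (- (s + 1) - 1)"] D[of _ "s + 1"] 1 2 a xa by auto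
  have e: "- (s + 1) = - s - 1" by simp
  have E: "\<xi>2 powr (- s - 1) - \<xi>1 powr (- s - 1) = (\<xi>1 - \<xi>2) * (s + 1) * \<eta> powr (- s - 2)"
    using 3(3) unfolding e by (simp add: algebra_simps)
  have "(x + a) powr - s + (x - a) powr - s - 2 * x powr - s = a * s * (\<xi>2 powr (- s - 1) - \<xi>1 powr (- s - 1))"
    using 1(3) 2(3) by (simp add: algebra_simps)
  also have "\<dots> = a * s * ((\<xi>1 - \<xi>2) * (s + 1) * \<eta> powr (- s - 2))"
    by (simp only: E)
  finally have eq: "(x + a) powr - s + (x - a) powr - s - 2 * x powr - s = a * s * ((\<xi>1 - \<xi>2) * (s + 1) * \<eta> powr (- s - 2))" .
  have "\<eta> powr (- s - 2) \<le> \<eta> powr - 2"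
    using s 3 2 xa by (intro powr_mono) auto
  also have "\<dots> \<le> (x - a) powr - 2"
    using 3 2 xa by (intro powr_mono2') auto
  also have "\<dots> = 1 / (x - a) ^ 2"
    using xa by (simp add: powr_minus_divide)
  finally have \<eta>: "\<eta> powr (- s - 2) \<le> 1 / (x - a) ^ 2" .
  have "(\<xi>1 - \<xi>2) * (s + 1) * \<eta> powr (- s - 2) \<le> (2 * a) * 2 * (1 / (x - a) ^ 2)"
    using 1 2 s a by (intro mult_mono \<eta>) auto
  then have "a * s * ((\<xi>1 - \<xi>2) * (s + 1) * \<eta> powr (- s - 2)) \<le> a * s * ((2 * a) * 2 * (1 / (x - a) ^ 2))"
    using a s by (intro mult_left_mono) auto
  moreover have "0 \<le> a * s * ((\<xi>1 - \<xi>2) * (s + 1) * \<eta> powr (- s - 2))"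
    using 1 2 s a by (intro mult_nonneg_nonneg) auto
  ultimately show ?thesis unfolding eq by (simp add: power2_eq_square mult_ac)
qed

lemma powr_minus_1_div_tendsto:
  assumes y: "y > (0::real)"
  shows "((\<lambda>s. (y powr - s - 1) / s) \<longlongrightarrow> - ln y) (at_right 0)"
proof -
  have "((\<lambda>s. y powr - s) has_real_derivative - ln y) (at 0)"
    using y by (auto intro!: derivative_eq_intros)
  then have "((\<lambda>s. (y powr - s - 1) / s) \<longlongrightarrow> - ln y) (at 0)"
    using y by (simp add: has_field_derivative_iff)
  from tendsto_within_subset[OF this, of "{0<..}"] show ?thesis by simp
qed

lemma ln_sin_product_sums:
  assumes y: "0 < y" "y < (1::real)"
  shows "(\<lambda>k. ln (1 - y ^ 2 / real (Suc k) ^ 2)) sums ln (sin (pi * y) / (pi * y))"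
proof -
  have sin: "sin (pi * y) > 0" using y by (intro sin_gt_zero) auto
  have pos: "1 - y ^ 2 / real (Suc k) ^ 2 > 0" for k
  proof -
    have "y ^ 2 < 1" using y by (simp add: power_less_one_iff)
    moreover have "1 \<le> real (Suc k) ^ 2" by (simp only: one_le_power of_nat_Suc)
    ultimately have "y ^ 2 < real (Suc k) ^ 2" by linarith
    then show ?thesis by simp
  qed
  have "(\<lambda>n. ln (\<Prod>k=1..n. 1 - y ^ 2 / of_nat k ^ 2)) \<longlonglongrightarrow> ln (sin (pi * y) / (pi * y))"
    using y sin by (intro tendsto_ln sin_product_formula_real') auto
  moreover have "ln (\<Prod>k=1..n. 1 - y ^ 2 / of_nat k ^ 2) = (\<Sum>k<n. ln (1 - y ^ 2 / real (Suc k) ^ 2))" for n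
  proof -
    have "(\<Prod>k=1..n. 1 - y ^ 2 / of_nat k ^ 2) = (\<Prod>k<n. 1 - y ^ 2 / real (Suc k) ^ 2)"
      by (rule prod.reindex_bij_witness[of _ Suc "\<lambda>n. n - 1"]) auto
    also have "ln \<dots> = (\<Sum>k<n. ln (1 - y ^ 2 / real (Suc k) ^ 2))"
    proof (rule ln_prod)
      show "1 - y ^ 2 / real (Suc k) ^ 2 \<noteq> 0" for k using pos[of k] by linarith
    qed simp
    finally show ?thesis .
  qed
  ultimately show ?thesis by (simp add: sums_def)
qed

lemma sum_reflect_character:
  fixes h :: "nat \<Rightarrow> complex"
  assumes D: "dirichlet_character q chi"
  shows "(\<Sum>b=1..<q. chi (int b) * h b) = chi (-1) * (\<Sum>b=1..<q. chi (int b) * h (q - b))"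
proof -
  have r: "chi (int (q - b)) = chi (-1) * chi (int b)" if "b < q" for b
  proof -
    have "chi (int (q - b)) = chi (- int b)"
      using that by (intro dirichlet_character_cong[OF D]) (simp add: cong_iff_dvd_diff)
    then show ?thesis by (simp only: dirichlet_character_uminus[OF D, of "int b"])
  qed
  have "(\<Sum>b=1..<q. chi (int b) * h b) = (\<Sum>b=1..<q. chi (int (q - b)) * h (q - b))"
    by (rule sum.reindex_bij_witness[of _ "\<lambda>b. q - b" "\<lambda>b. q - b"]) auto
  also have "\<dots> = (\<Sum>b=1..<q. chi (-1) * (chi (int b) * h (q - b)))"
  proof (rule sum.cong[OF refl])
    fix b assume "b \<in> {1..<q}"
    then have "b < q" by simp
    then show "chi (int (q - b)) * h (q - b) = chi (-1) * (chi (int b) * h (q - b))"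
      by (simp only: r mult.assoc)
  qed
  finally show ?thesis by (simp add: sum_distrib_left)
qed

lemma sum_dirichlet_character_from_1:
  assumes D: "dirichlet_character q chi" and q: "q > 1"
  shows "(\<Sum>b=1..<q. chi (int b) * h b) = (\<Sum>b<q. chi (int b) * h b)"
proof -
  have "chi 0 = 0" using dirichlet_character_nonzero_iff[OF D, of 0] q by auto
  then show ?thesis
    by (intro sum.mono_neutral_left) (auto simp: not_less_eq_eq Suc_le_eq)
qed

text \<open>
  For even \<open>chi\<close> the sum of \<open>chi(n) n powr -s\<close> over a block of length \<open>q\<close> can be expanded from either
  end of the block. Adding two consecutive blocks, expanded from their common end, gives second
  differences of \<open>t powr -s\<close>, which are \<open>O(s/k\<^sup>2)\<close>; hence \<open>L(s)/s\<close> has a termwise limit, which Euler's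
  sine product evaluates.
\<close>

lemma dirichlet_L_even_div_tendsto_at_0:
  assumes D: "dirichlet_character q chi" and c: "coprime c (int q)" "chi c \<noteq> 1"
    and q: "q > 1" and even: "chi (-1) = 1"
  shows "((\<lambda>s. dirichlet_series (\<lambda>n. chi (int n)) s / of_real s) \<longlongrightarrow>
    - (\<Sum>b=1..<q. chi (int b) * of_real (ln (sin (pi * (real b / real q))))) / 2) (at_right 0)"
proof -
  obtain B where B: "\<And>n. norm (\<Sum>k<n. chi (int (Suc k))) \<le> B"
    using dirichlet_character_partial_sums(2)[OF D c] by blast
  have z: "(\<Sum>b=1..<q. chi (int b)) = 0"
    using sum_dirichlet_character_from_1[OF D q, of "\<lambda>_. 1"] sum_dirichlet_character_eq_0[OF D c] by simp
  have zc: "(\<Sum>b=1..<q. chi (int b) * C) = 0" for C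
    using z by (simp add: sum_distrib_right [symmetric])
  \<comment> \<open>The subtracted \<open>2 * real (Suc k * q) powr - s\<close> does not depend on
    b, so it costs nothing against a character sum that vanishes (\<open>zc\<close>); the same holds
    for the -1 in \<beta>. Both make the quotients by \<open>s\<close> converge.\<close>
  define \<phi> where "\<phi> b k s = (real (Suc k * q) + real b) powr - s + (real (Suc k * q) - real b) powr - s
    - 2 * real (Suc k * q) powr - s" for b k :: nat and s :: real
  \<comment> \<open>The first block has no left neighbour: twice the series is block 0 plus the sum
    over all adjacent pairs of blocks, and \<beta> carries block 0.\<close>
  define \<beta> where "\<beta> s = (\<Sum>b=1..<q. chi (int b) * of_real ((real b powr - s - 1) / s))" for s
  define g where "g k s = (\<Sum>b=1..<q. chi (int b) * of_real (\<phi> b k s / s))" for k s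
  have split: "2 * (dirichlet_series (\<lambda>n. chi (int n)) s / of_real s) = \<beta> s + (\<Sum>k. g k s)" if s: "s > 0" for s
  proof -
    define F where "F = dirichlet_series (\<lambda>n. chi (int n)) s"
    define t where "t = dirichlet_term (\<lambda>n. chi (int n)) s"
    have "t sums F"
      using summable_sums[OF summable_dirichlet_term_bounded(1)[of "\<lambda>n. chi (int n)", OF B s]]
      unfolding sums_dirichlet_term_Suc_iff [symmetric] t_def F_def dirichlet_series_def .
    then have S: "(\<lambda>k. sum t {k * q..<k * q + q}) sums F"
      using q by (intro sums_group) auto
    define b where "b k = (\<Sum>b=1..<q. chi (int b) * of_real ((real (k * q) + real b) powr - s))" for k
    have "sum t {k * q..<k * q + q} = b k" for k
    proof -
      have "sum t {k * q..<k * q + q} = (\<Sum>b<q. t (b + k * q))"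
        using sum.shift_bounds_nat_ivl[of t 0 "k * q" q] by (simp add: atLeast0LessThan add.commute)
      also have "\<dots> = (\<Sum>b<q. chi (int b) * of_real ((real (k * q) + real b) powr - s))"
      proof (rule sum.cong[OF refl])
        fix b
        have "chi (int (b + k * q)) = chi (int b)"
          by (rule dirichlet_character_cong[OF D]) (simp add: cong_def)
        then show "t (b + k * q) = chi (int b) * of_real ((real (k * q) + real b) powr - s)"
          by (simp add: t_def dirichlet_term_def add.commute)
      qed
      also have "\<dots> = b k"
        unfolding b_def by (rule sum_dirichlet_character_from_1[OF D q, symmetric])
      finally show ?thesis .
    qed
    then have b: "b sums F" using S by simp
    have b': "b k = (\<Sum>b=1..<q. chi (int b) * of_real ((real (Suc k * q) - real b) powr - s))" for k
    proof -
      have "b k = (\<Sum>b=1..<q. chi (int b) * of_real ((real (k * q) + real (q - b)) powr - s))"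
        unfolding b_def using sum_reflect_character[OF D, of "\<lambda>b. of_real ((real (k * q) + real b) powr - s)"]
        by (simp add: even)
      also have "\<dots> = (\<Sum>b=1..<q. chi (int b) * of_real ((real (Suc k * q) - real b) powr - s))"
        by (rule sum.cong[OF refl]) (auto simp: algebra_simps of_nat_diff)
      finally show ?thesis .
    qed
    have "b (Suc k) + b k = of_real s * g k s" for k
    proof -
      have "of_real s * g k s = (\<Sum>b=1..<q. chi (int b) * of_real (\<phi> b k s))"
        using s by (simp add: g_def sum_distrib_left mult_ac)
      also have "\<dots> = b (Suc k) + b k - (\<Sum>b=1..<q. chi (int b) * of_real (2 * real (Suc k * q) powr - s))"
        unfolding b'[of k] unfolding b_def \<phi>_def sum.distrib [symmetric] sum_subtractf [symmetric]
        by (rule sum.cong[OF refl]) (simp add: algebra_simps)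
      finally show ?thesis unfolding zc by simp
    qed
    moreover have "(\<lambda>k. b (Suc k) + b k) sums (F - b 0 + F)"
      using b sums_Suc_iff[of b "F - b 0"] by (intro sums_add) auto
    ultimately have "(\<lambda>k. of_real s * g k s) sums (F - b 0 + F)" by simp
    then have "(\<lambda>k. of_real s * g k s / of_real s) sums ((F - b 0 + F) / of_real s)"
      by (rule sums_divide)
    then have "(\<Sum>k. g k s) = (F - b 0 + F) / of_real s"
      using s by (simp add: sums_iff)
    moreover have "\<beta> s = b 0 / of_real s"
    proof -
      have "\<beta> s = (\<Sum>b=1..<q. chi (int b) * of_real (real b powr - s) / of_real s - chi (int b) * of_real (1 / s))"
        unfolding \<beta>_def by (rule sum.cong[OF refl]) (simp add: diff_divide_distrib right_diff_distrib)
      then show ?thesis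
        unfolding sum_subtractf zc by (simp add: b_def sum_divide_distrib)
    qed
    ultimately show ?thesis using s by (simp add: F_def [symmetric] add_divide_distrib diff_divide_distrib)
  qed
  \<comment> \<open>As b <= q - 1, even the smallest of the three points is at least k + 1, so the
    second differences have the summable majorant 4 b^2/(k + 1)^2.\<close>
  have xb: "real (Suc k * q) - real b \<ge> real (Suc k)" if "b \<in> {1..<q}" for b k
  proof -
    have "Suc k + b \<le> Suc k * q"
    proof -
      have "k \<le> k * q" "b < q" using q that by simp_all
      then have "Suc k + b \<le> q + k * q" by linarith
      then show ?thesis by simp
    qed
    then show ?thesis by (simp only: le_diff_eq of_nat_add [symmetric] of_nat_le_iff)
  qed
  have \<beta>: "(\<beta> \<longlongrightarrow> (\<Sum>b=1..<q. chi (int b) * of_real (- ln (real b)))) (at_right 0)"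
    unfolding \<beta>_def by (intro tendsto_sum tendsto_mult tendsto_const tendsto_of_real powr_minus_1_div_tendsto) auto
  \<comment> \<open>With x = (k + 1) q this is -ln((x + b)(x - b)/x^2), minus the logarithm of a
    factor of the sine product at b/q.\<close>
  define \<gamma> where "\<gamma> b k = - ln (1 - (real b / real q) ^ 2 / real (Suc k) ^ 2)" for b k
  define G where "G k = (\<Sum>b=1..<q. chi (int b) * of_real (\<gamma> b k))" for k
  have glim: "((\<lambda>s. g k s) \<longlongrightarrow> G k) (at_right 0)" for k
  proof -
    have "((\<lambda>s. \<phi> b k s / s) \<longlongrightarrow> \<gamma> b k) (at_right 0)" if b: "b \<in> {1..<q}" for b
    proof -
      define x where "x = real (Suc k * q)"
      have x: "x - real b > 0" "x > 0" "x + real b > 0"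
        using xb[OF b, of k] q by (auto simp: x_def)
      have eq: "\<phi> b k s / s = ((x + real b) powr - s - 1) / s + ((x - real b) powr - s - 1) / s
        - 2 * ((x powr - s - 1) / s)" for s
        unfolding \<phi>_def x_def [symmetric] by (simp add: add_divide_distrib diff_divide_distrib)
      have "((\<lambda>s. \<phi> b k s / s) \<longlongrightarrow> - ln (x + real b) + - ln (x - real b) - 2 * - ln x) (at_right 0)"
        unfolding eq by (intro tendsto_intros powr_minus_1_div_tendsto x)
      moreover have "- ln (x + real b) + - ln (x - real b) - 2 * - ln x = - ln ((x + real b) * (x - real b) / x ^ 2)"
        using x by (simp add: ln_mult ln_div ln_realpow)
      moreover have "(x + real b) * (x - real b) / x ^ 2 = 1 - (real b / real q) ^ 2 / real (Suc k) ^ 2"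
      proof -
        have bx: "(real b / real q) ^ 2 / real (Suc k) ^ 2 = real b ^ 2 / x ^ 2"
          unfolding x_def of_nat_mult power_divide power_mult_distrib by (simp add: mult.commute del: of_nat_Suc)
        show ?thesis unfolding bx using x by (simp add: field_simps power2_eq_square)
      qed
      ultimately show ?thesis by (simp add: \<gamma>_def)
    qed
    then show ?thesis
      unfolding g_def G_def by (intro tendsto_sum tendsto_mult tendsto_const tendsto_of_real) auto
  qed
  define M where "M k = (\<Sum>b=1..<q. 4 * real b ^ 2 * (1 / real (Suc k) ^ 2))" for k
  have gM: "norm (g k s) \<le> M k" if s: "0 < s" "s \<le> 1" for k s
    unfolding g_def M_def
  proof (rule sum_norm_le)
    fix b assume b: "b \<in> {1..<q}"
    define x where "x = real (Suc k * q)"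
    have x: "x - real b \<ge> real (Suc k)" using xb[OF b, of k] by (simp only: x_def)
    have "\<bar>\<phi> b k s\<bar> \<le> 4 * real b ^ 2 * s / (x - real b) ^ 2"
      unfolding \<phi>_def x_def [symmetric] using b x by (intro powr_second_difference_bound s) auto
    also have "\<dots> \<le> 4 * real b ^ 2 * s / real (Suc k) ^ 2"
      using x s by (intro divide_left_mono power_mono mult_pos_pos zero_less_power) auto
    finally have "\<bar>\<phi> b k s / s\<bar> \<le> 4 * real b ^ 2 * (1 / real (Suc k) ^ 2)"
      using s by (simp add: abs_divide pos_divide_le_eq mult_ac)
    then have "norm (chi (int b)) * \<bar>\<phi> b k s / s\<bar> \<le> 1 * (4 * real b ^ 2 * (1 / real (Suc k) ^ 2))"
      using norm_dirichlet_character_le[OF D] by (intro mult_mono) auto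
    then show "norm (chi (int b) * of_real (\<phi> b k s / s)) \<le> 4 * real b ^ 2 * (1 / real (Suc k) ^ 2)"
      unfolding norm_mult norm_of_real by simp
  qed
  have SM: "summable M"
    unfolding M_def
    using inverse_power_summable[of 2, where 'a = real] summable_Suc_iff[of "\<lambda>n. inverse (real n ^ 2)"]
    by (intro summable_sum summable_mult) (simp add: inverse_eq_divide)
  have "((\<lambda>s. \<Sum>k. g k s) \<longlongrightarrow> (\<Sum>k. G k)) (at_right 0)"
  proof (rule conjunct2[OF conjunct2[OF tannerys_theorem[where M = M]]])
    show "\<forall>\<^sub>F (k, s) in at_top \<times>\<^sub>F at_right 0. norm (g k s) \<le> M k"
    proof (rule eventually_mono[OF eventually_prodI])
      show "\<forall>\<^sub>F k in at_top. True" by simp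
      show "\<forall>\<^sub>F s::real in at_right 0. 0 < s \<and> s \<le> 1"
        by (auto simp: eventually_at_right_field intro!: exI[of _ 1])
    qed (auto intro!: gM)
  qed (use glim SM in auto)
  moreover have "(\<Sum>k. G k) = (\<Sum>b=1..<q. chi (int b) * of_real (- ln (sin (pi * (real b / real q)) / (pi * (real b / real q)))))"
  proof (rule sums_unique[symmetric])
    show "G sums (\<Sum>b=1..<q. chi (int b) * of_real (- ln (sin (pi * (real b / real q)) / (pi * (real b / real q)))))"
      unfolding G_def \<gamma>_def
      by (intro sums_sum sums_mult sums_of_real sums_minus ln_sin_product_sums) (use q in auto)
  qed
  ultimately have lim: "((\<lambda>s. \<beta> s + (\<Sum>k. g k s)) \<longlongrightarrow> (\<Sum>b=1..<q. chi (int b) * of_real (- ln (real b)))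
     + (\<Sum>b=1..<q. chi (int b) * of_real (- ln (sin (pi * (real b / real q)) / (pi * (real b / real q)))))) (at_right 0)"
    using tendsto_add[OF \<beta>] by simp
  \<comment> \<open>The \<open>ln b\<close> of block 0 cancels the one in the denominator of the
    sine product, and the remaining constant ln q - ln pi is annihilated by the character
    sum.\<close>
  have "(\<Sum>b=1..<q. chi (int b) * of_real (- ln (real b)))
     + (\<Sum>b=1..<q. chi (int b) * of_real (- ln (sin (pi * (real b / real q)) / (pi * (real b / real q)))))
     = (\<Sum>b=1..<q. chi (int b) * of_real (- ln (sin (pi * (real b / real q)))) - chi (int b) * of_real (ln (real q) - ln pi))"
    unfolding sum.distrib [symmetric]
  proof (rule sum.cong[OF refl])
    fix b assume b: "b \<in> {1..<q}"
    have "sin (pi * (real b / real q)) > 0"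
      using b q by (intro sin_gt_zero) (auto simp: field_simps)
    then have lnE: "ln (sin (pi * (real b / real q)) / (pi * (real b / real q)))
      = ln (sin (pi * (real b / real q))) - (ln pi + (ln (real b) - ln (real q)))"
      using b q by (simp add: ln_div ln_mult)
    show "chi (int b) * of_real (- ln (real b)) + chi (int b) * of_real (- ln (sin (pi * (real b / real q)) / (pi * (real b / real q))))
      = chi (int b) * of_real (- ln (sin (pi * (real b / real q)))) - chi (int b) * of_real (ln (real q) - ln pi)"
      unfolding lnE by (simp add: algebra_simps)
  qed
  also have "\<dots> = - (\<Sum>b=1..<q. chi (int b) * of_real (ln (sin (pi * (real b / real q)))))"
    unfolding sum_subtractf zc by (simp add: sum_negf)
  finally have "((\<lambda>s. \<beta> s + (\<Sum>k. g k s)) \<longlongrightarrow> - (\<Sum>b=1..<q. chi (int b) * of_real (ln (sin (pi * (real b / real q)))))) (at_right 0)"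
    using lim by simp
  then have "((\<lambda>s. 2 * (dirichlet_series (\<lambda>n. chi (int n)) s / of_real s)) \<longlongrightarrow>
      - (\<Sum>b=1..<q. chi (int b) * of_real (ln (sin (pi * (real b / real q)))))) (at_right 0)"
    by (rule Lim_transform_eventually)
      (use split in \<open>auto simp: eventually_at_right_field intro!: exI[of _ 1]\<close>)
  from tendsto_divide[OF this tendsto_const[of 2]] show ?thesis by simp
qed

section \<open>The value at one as a finite sum of logarithms\<close>

lemma Ln_one_minus_cis:
  assumes h: "0 < h" "h < pi"
  shows "Ln (1 - cis (2 * h)) = Complex (ln (2 * sin h)) (h - pi / 2)"
proof (rule Ln_unique)
  \<comment> \<open>Here 1 - cis(2h) = 2 sin h cis(h - pi/2), and the angle lies inside (-pi/2,
    pi/2), so it is the principal one.\<close>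
  have s: "sin h > 0" using h by (rule sin_gt_zero)
  show "exp (Complex (ln (2 * sin h)) (h - pi / 2)) = 1 - cis (2 * h)"
    using s by (simp add: complex_eq_iff exp_eq_polar Re_exp Im_exp cos_diff sin_diff cos_double_sin sin_double power2_eq_square)
qed (use h in auto)

text \<open>The Gauss sum turns cnj(chi(n)) into a finite combination of n-th powers of roots of
  unity \<omega>, and the sum of \<omega>^n/n is -Ln(1 - \<omega>). As \<omega> lies on the boundary
  of the disc of convergence, a factor r^n is inserted and r tends to 1.\<close>

lemma dirichlet_L_1_gauss_sum:
  assumes P: "primitive_dirichlet_character q chi" and q: "q > 1"
    and c: "coprime c (int q)" "chi c \<noteq> 1"
  shows "gauss_sum q chi 1 * dirichlet_series (\<lambda>n. cnj (chi (int n))) 1 =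
    - (\<Sum>b=1..<q. chi (int b) * Complex (ln (2 * sin (pi * (real b / real q)))) (pi * (real b / real q) - pi / 2))"
proof -
  have D: "dirichlet_character q chi" using P by (simp add: primitive_dirichlet_character_def)
  define a where "a k = cnj (chi (int (Suc k)))" for k
  have "cnj (chi c) \<noteq> 1" using c(2) by (metis complex_cnj_cnj complex_cnj_one)
  then obtain B where B: "\<And>n. norm (\<Sum>k<n. a k) \<le> B"
    using dirichlet_character_partial_sums(2)[OF dirichlet_character_cnj[OF D] c(1)] unfolding a_def by blast
  define w where "w r k = r ^ Suc k / real (Suc k)" for r :: real and k
  define v where "v k = 1 / real (Suc k)" for k
  have v: "decseq v" "v \<longlonglongrightarrow> 0"
    using LIMSEQ_inverse_real_of_nat by (auto simp: v_def [abs_def] decseq_Suc_iff field_simps inverse_eq_divide)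
  have lim1: "((\<lambda>r. \<Sum>k. a k * of_real (w r k)) \<longlongrightarrow> (\<Sum>k. a k * of_real (v k))) (at_left 1)"
  proof (rule dirichlet_test_tendsto[OF B, where X = "{0<..<1}" and W = v])
    fix r :: real assume r: "r \<in> {0<..<1}"
    show "decseq (w r)" unfolding decseq_Suc_iff w_def
    proof
      fix k
      have "r ^ Suc (Suc k) \<le> r ^ Suc k" using r by (intro power_decreasing) auto
      then show "r ^ Suc (Suc k) / real (Suc (Suc k)) \<le> r ^ Suc k / real (Suc k)"
        using r by (intro frac_le) auto
    qed
    fix n
    show "0 \<le> w r n" using r by (simp add: w_def)
    have "r ^ Suc n \<le> 1" using r by (intro power_le_one) auto
    then show "w r n \<le> v n" unfolding w_def v_def by (intro divide_right_mono) auto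
  next
    fix n
    have "((\<lambda>r. w r n) \<longlongrightarrow> 1 ^ Suc n / real (Suc n)) (at_left 1)"
      unfolding w_def by (intro tendsto_intros) auto
    then show "((\<lambda>r. w r n) \<longlongrightarrow> v n) (at_left 1)" by (simp add: v_def)
  next
    show "\<forall>\<^sub>F r::real in at_left 1. r \<in> {0<..<1}"
      by (auto simp: eventually_at_left_field intro!: exI[of _ 0])
  qed (use v in auto)
  have av: "(\<Sum>k. a k * of_real (v k)) = dirichlet_series (\<lambda>n. cnj (chi (int n))) 1"
    by (simp add: dirichlet_series_def dirichlet_term_def a_def v_def powr_minus_divide)
  define \<omega> where "\<omega> b = unit_root q (int b)" for b
  have key: "gauss_sum q chi 1 * (\<Sum>k. a k * of_real (w r k)) = - (\<Sum>b=1..<q. chi (int b) * Ln (1 - of_real r * \<omega> b))"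
    if r: "r \<in> {0<..<1}" for r
  proof -
    have "(\<lambda>n. - ((of_real r * \<omega> b) ^ n) / of_nat n) sums Ln (1 - of_real r * \<omega> b)" for b
      using Ln_series'[of "- (of_real r * \<omega> b)"] r by (simp add: norm_mult \<omega>_def)
    then have "(\<lambda>n. - (\<Sum>b=1..<q. chi (int b) * (- ((of_real r * \<omega> b) ^ n) / of_nat n)))
      sums (- (\<Sum>b=1..<q. chi (int b) * Ln (1 - of_real r * \<omega> b)))"
      by (intro sums_minus sums_sum sums_mult)
    moreover have "- (\<Sum>b=1..<q. chi (int b) * (- ((of_real r * \<omega> b) ^ n) / of_nat n))
      = gauss_sum q chi 1 * (cnj (chi (int n)) * of_real (r ^ n / real n))" for n
    proof -
      have "- (\<Sum>b=1..<q. chi (int b) * (- ((of_real r * \<omega> b) ^ n) / of_nat n))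
        = (\<Sum>b=1..<q. chi (int b) * (\<omega> b ^ n * of_real (r ^ n / real n)))"
        by (simp add: sum_negf [symmetric] power_mult_distrib mult_ac)
      also have "\<dots> = (\<Sum>b<q. chi (int b) * (\<omega> b ^ n * of_real (r ^ n / real n)))"
        by (rule sum_dirichlet_character_from_1[OF D q])
      also have "\<dots> = gauss_sum q chi (int n) * of_real (r ^ n / real n)"
        by (simp only: gauss_sum_def sum_distrib_right \<omega>_def unit_root_power mult.assoc)
      finally show ?thesis
        using gauss_sum_primitive[OF P, of "int n"] by (simp add: mult_ac)
    qed
    ultimately have "(\<lambda>n. gauss_sum q chi 1 * (cnj (chi (int n)) * of_real (r ^ n / real n)))
      sums (- (\<Sum>b=1..<q. chi (int b) * Ln (1 - of_real r * \<omega> b)))" by simp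
    then have "(\<lambda>n. gauss_sum q chi 1 * (cnj (chi (int (Suc n))) * of_real (r ^ Suc n / real (Suc n))))
      sums (- (\<Sum>b=1..<q. chi (int b) * Ln (1 - of_real r * \<omega> b)))"
      by (subst sums_Suc_iff) simp
    then have S: "(\<lambda>n. gauss_sum q chi 1 * (a n * of_real (w r n)))
      sums (- (\<Sum>b=1..<q. chi (int b) * Ln (1 - of_real r * \<omega> b)))"
      by (simp only: a_def w_def)
    then have "summable (\<lambda>n. a n * of_real (w r n))"
      using sums_summable[OF S] gauss_sum_1_nonzero[OF P] by (simp add: summable_cmult_iff)
    then show ?thesis
      using sums_unique[OF S] by (simp add: suminf_mult)
  qed
  have Ln: "Ln (1 - \<omega> b) = Complex (ln (2 * sin (pi * (real b / real q)))) (pi * (real b / real q) - pi / 2)"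
    if b: "b \<in> {1..<q}" for b
  proof -
    have "\<omega> b = cis (2 * (pi * (real b / real q)))"
      unfolding \<omega>_def unit_root_def by (rule arg_cong[where f = cis]) simp
    then show ?thesis
      using b q by (simp only:) (rule Ln_one_minus_cis, auto simp: field_simps)
  qed
  have "((\<lambda>r. - (\<Sum>b=1..<q. chi (int b) * Ln (1 - of_real r * \<omega> b))) \<longlongrightarrow>
    - (\<Sum>b=1..<q. chi (int b) * Ln (1 - of_real 1 * \<omega> b))) (at_left 1)"
  proof (intro tendsto_minus tendsto_sum tendsto_mult tendsto_const tendsto_Ln tendsto_diff tendsto_of_real tendsto_ident_at)
    fix b assume b: "b \<in> {1..<q}"
    \<comment> \<open>A point of the unit circle other than 1 has real part below 1, so 1 - \<omega>
      stays off the branch cut.\<close>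
    have "\<not> int q dvd int b" using b by (auto simp: nat_dvd_not_less)
    then have "\<omega> b \<noteq> 1" using unit_root_eq_1_iff[of q "int b"] q by (simp add: \<omega>_def)
    moreover have "norm (\<omega> b) = 1" by (simp add: \<omega>_def)
    ultimately show "1 - of_real 1 * \<omega> b \<notin> \<real>\<^sub>\<le>\<^sub>0"
      using abs_Re_le_cmod[of "\<omega> b"]
      by (auto simp: complex_nonpos_Reals_iff complex_eq_iff)
  qed
  then have lim2: "((\<lambda>r. gauss_sum q chi 1 * (\<Sum>k. a k * of_real (w r k))) \<longlongrightarrow>
    - (\<Sum>b=1..<q. chi (int b) * Ln (1 - of_real 1 * \<omega> b))) (at_left 1)"
    by (rule Lim_transform_eventually)
      (use key in \<open>auto simp: eventually_at_left_field intro!: exI[of _ 0]\<close>)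
  have "gauss_sum q chi 1 * (\<Sum>k. a k * of_real (v k)) = - (\<Sum>b=1..<q. chi (int b) * Ln (1 - of_real 1 * \<omega> b))"
    by (rule tendsto_unique[OF _ tendsto_mult_left[OF lim1] lim2]) simp
  also have "(\<Sum>b=1..<q. chi (int b) * Ln (1 - of_real 1 * \<omega> b))
    = (\<Sum>b=1..<q. chi (int b) * Complex (ln (2 * sin (pi * (real b / real q)))) (pi * (real b / real q) - pi / 2))"
    by (rule sum.cong[OF refl]) (simp add: Ln)
  finally show ?thesis unfolding av .
qed

lemma primitive_nonprincipal:
  assumes P: "primitive_dirichlet_character q chi" and q: "q > 1"
  obtains c where "coprime c (int q)" "chi c \<noteq> 1"
  using primitive_imp_ex_nontrivial[OF P, of 1] q by auto

text \<open>Under b -> q - b the logarithm of 2 sin(pi b/q) is symmetric and the angle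
  antisymmetric. An even \<open>chi\<close> annihilates the angles and an odd one the logarithms, so
  this one statement gives the non-vanishing required for either parity.\<close>

lemma gauss_log_sum_nonzero:
  assumes P: "primitive_dirichlet_character q chi" and q: "q > 1"
  shows "(\<Sum>b=1..<q. chi (int b) * Complex (ln (2 * sin (pi * (real b / real q)))) (pi * (real b / real q) - pi / 2)) \<noteq> 0"
proof -
  have D: "dirichlet_character q chi" using P by (simp add: primitive_dirichlet_character_def)
  obtain c where c: "coprime c (int q)" "chi c \<noteq> 1" using primitive_nonprincipal[OF P q] .
  have "cnj (chi c) \<noteq> 1" using c(2) by (metis complex_cnj_cnj complex_cnj_one)
  then have "dirichlet_series (\<lambda>n. cnj (chi (int n))) 1 \<noteq> 0"
    using dirichlet_L_1_nonzero[OF dirichlet_character_cnj[OF D] c(1)] by simp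
  then show ?thesis
    using dirichlet_L_1_gauss_sum[OF P q c] gauss_sum_1_nonzero[OF P] by auto
qed

lemma dirichlet_L_odd_tendsto_at_0:
  assumes P: "primitive_dirichlet_character q chi" and q: "q > 1" and odd: "chi (-1) = -1"
  obtains l where "l \<noteq> 0" "(dirichlet_series (\<lambda>n. chi (int n)) \<longlongrightarrow> l) (at_right 0)"
proof -
  have D: "dirichlet_character q chi" using P by (simp add: primitive_dirichlet_character_def)
  obtain c where c: "coprime c (int q)" "chi c \<noteq> 1" using primitive_nonprincipal[OF P q] .
  define s where "s b = ln (2 * sin (pi * (real b / real q)))" for b
  have srefl: "s (q - b) = s b" if "b \<in> {1..<q}" for b
  proof -
    have "pi * (real (q - b) / real q) = pi - pi * (real b / real q)"
      using that by (simp add: of_nat_diff field_simps)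
    then show ?thesis by (simp only: s_def sin_pi_minus)
  qed
  have "(\<Sum>b=1..<q. chi (int b) * of_real (s b)) = - (\<Sum>b=1..<q. chi (int b) * of_real (s (q - b)))"
    using sum_reflect_character[OF D, of "\<lambda>b. of_real (s b)"] odd by simp
  also have "(\<Sum>b=1..<q. chi (int b) * of_real (s (q - b))) = (\<Sum>b=1..<q. chi (int b) * of_real (s b))"
    by (rule sum.cong) (auto simp: srefl)
  finally have s0: "(\<Sum>b=1..<q. chi (int b) * of_real (s b)) = 0" by simp
  have z: "(\<Sum>b=1..<q. chi (int b)) = 0"
    using sum_dirichlet_character_from_1[OF D q, of "\<lambda>_. 1"] sum_dirichlet_character_eq_0[OF D c] by simp
  \<comment> \<open>The first moment of \<open>chi\<close> is what the angles leave of the nonzero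
    sum once the logarithms cancel; the value of the L-function at 0 turns out to be -A/q.\<close>
  define A where "A = (\<Sum>b=1..<q. chi (int b) * of_nat b)"
  have "(\<Sum>b=1..<q. chi (int b) * Complex (s b) (pi * (real b / real q) - pi / 2))
    = (\<Sum>b=1..<q. chi (int b) * of_real (s b) + \<i> * of_real (pi / real q) * (chi (int b) * of_nat b) - \<i> * of_real (pi / 2) * chi (int b))"
    by (rule sum.cong[OF refl]) (simp add: Complex_eq algebra_simps)
  also have "\<dots> = \<i> * of_real (pi / real q) * A"
    unfolding sum_subtractf sum.distrib s0 sum_distrib_left [symmetric] z A_def by simp
  finally have A: "A \<noteq> 0"
    using gauss_log_sum_nonzero[OF P q] unfolding s_def by auto
  define a where "a k = chi (int (Suc k))" for k
  have per: "chi (n + int q) = chi n" for n using D by (simp add: dirichlet_character_def)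
  have za: "(\<Sum>k<q. a k) = 0"
    unfolding a_def by (rule dirichlet_character_partial_sums(1)[OF D c])
  have lim: "(dirichlet_series (\<lambda>n. chi (int n)) \<longlongrightarrow> (\<Sum>k<q. \<Sum>j\<le>k. a j) / of_nat q) (at_right 0)"
    unfolding a_def
    by (rule dirichlet_series_tendsto_at_0)
      (use q per za in \<open>auto simp: a_def\<close>)
  have "chi (int q) = 0" using dirichlet_character_nonzero_iff[OF D, of "int q"] q by auto
  then have "(\<Sum>j<q. of_nat (Suc j) * a j) = (\<Sum>b<q. chi (int b) * of_nat b)"
    using sum.lessThan_Suc_shift[of "\<lambda>b. chi (int b) * of_nat b" q] by (simp add: a_def mult.commute)
  also have "\<dots> = A"
    unfolding A_def by (rule sum_dirichlet_character_from_1[OF D q, symmetric])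
  finally have "(\<Sum>j<q. of_nat j * a j) = A"
    using za by (simp add: ring_distribs sum.distrib)
  then have "(\<Sum>k<q. \<Sum>j\<le>k. a j) = - A"
    using sum_partial_sums[of a q] za by (simp add: eq_neg_iff_add_eq_0)
  then have "(\<Sum>k<q. \<Sum>j\<le>k. a j) / of_nat q \<noteq> 0" using A q by simp
  then show thesis using lim by (rule that)
qed

lemma dirichlet_L_even_div_tendsto_nonzero_at_0:
  assumes P: "primitive_dirichlet_character q chi" and q: "q > 1" and even: "chi (-1) = 1"
  obtains l where "l \<noteq> 0" "((\<lambda>s. dirichlet_series (\<lambda>n. chi (int n)) s / of_real s) \<longlongrightarrow> l) (at_right 0)"
proof -
  have D: "dirichlet_character q chi" using P by (simp add: primitive_dirichlet_character_def)
  obtain c where c: "coprime c (int q)" "chi c \<noteq> 1" using primitive_nonprincipal[OF P q] .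
  have z: "(\<Sum>b=1..<q. chi (int b)) = 0"
    using sum_dirichlet_character_from_1[OF D q, of "\<lambda>_. 1"] sum_dirichlet_character_eq_0[OF D c] by simp
  define t where "t b = pi * (real b / real q) - pi / 2" for b
  have trefl: "t (q - b) = - t b" if "b \<in> {1..<q}" for b
    using that by (simp add: t_def of_nat_diff field_simps)
  have "(\<Sum>b=1..<q. chi (int b) * of_real (t b)) = (\<Sum>b=1..<q. chi (int b) * of_real (t (q - b)))"
    using sum_reflect_character[OF D, of "\<lambda>b. of_real (t b)"] even by simp
  also have "\<dots> = (\<Sum>b=1..<q. - (chi (int b) * of_real (t b)))"
    by (rule sum.cong) (auto simp: trefl)
  finally have t0: "(\<Sum>b=1..<q. chi (int b) * of_real (t b)) = 0" by (simp add: sum_negf)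
  have "(\<Sum>b=1..<q. chi (int b) * Complex (ln (2 * sin (pi * (real b / real q)))) (pi * (real b / real q) - pi / 2))
    = (\<Sum>b=1..<q. chi (int b) * of_real (ln (sin (pi * (real b / real q)))) + of_real (ln 2) * chi (int b) + \<i> * (chi (int b) * of_real (t b)))"
  proof (rule sum.cong[OF refl])
    fix b assume b: "b \<in> {1..<q}"
    have "sin (pi * (real b / real q)) > 0"
      using b q by (intro sin_gt_zero) (auto simp: field_simps)
    then show "chi (int b) * Complex (ln (2 * sin (pi * (real b / real q)))) (pi * (real b / real q) - pi / 2)
      = chi (int b) * of_real (ln (sin (pi * (real b / real q)))) + of_real (ln 2) * chi (int b) + \<i> * (chi (int b) * of_real (t b))"
      unfolding t_def [symmetric] by (simp add: ln_mult Complex_eq algebra_simps)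
  qed
  also have "\<dots> = (\<Sum>b=1..<q. chi (int b) * of_real (ln (sin (pi * (real b / real q)))))"
    unfolding sum.distrib sum_distrib_left [symmetric] z t0 by simp
  finally have "(\<Sum>b=1..<q. chi (int b) * of_real (ln (sin (pi * (real b / real q))))) \<noteq> 0"
    using gauss_log_sum_nonzero[OF P q] by simp
  then show thesis
    using that[OF _ dirichlet_L_even_div_tendsto_at_0[OF D c q even]] by simp
qed

section \<open>Changing finitely many primes\<close>

lemma completely_multiplicative_prime_eq:
  assumes f: "completely_multiplicative f" and D: "dirichlet_character q chi"
    and eq: "\<And>p. prime p \<Longrightarrow> p \<notin> S \<Longrightarrow> f p = chi (int p)"
    and n: "n > 0" "\<And>p. p \<in> S \<Longrightarrow> \<not> p dvd n"
  shows "f n = chi (int n)"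
  using n
proof (induction n rule: less_induct)
  case (less n)
  show ?case
  proof (cases "n = 1")
    case True
    then show ?thesis
      using f dirichlet_character_1[OF D] by (simp add: completely_multiplicative_def)
  next
    case False
    then obtain p where p: "prime p" "p dvd n" using prime_factor_nat by blast
    then obtain m where m: "n = p * m" by (auto elim: dvdE)
    have m0: "m > 0" using m less.prems(1) by (auto intro: Nat.gr0I)
    have "m < n" using m m0 prime_gt_1_nat[OF p(1)] by simp
    then have "f m = chi (int m)"
      using less m0 m by (meson dvd_mult)
    moreover have "f p = chi (int p)" using eq p less.prems(2) by blast
    moreover have "f n = f p * f m"
      using f m m0 prime_gt_0_nat[OF p(1)] by (simp add: completely_multiplicative_def)
    ultimately show ?thesis by (simp add: m dirichlet_character_mult[OF D])
  qed
qed

text \<open>Sieving by the primes in \<open>S\<close> leaves indices with all prime factors outside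
  \<open>S\<close>. There \<open>f\<close> and \<open>chi\<close> agree, so the two sieved series
  coincide term by term and have one sum.\<close>

lemma dirichlet_series_finite_change:
  assumes f: "completely_multiplicative f" and D: "dirichlet_character q chi"
    and S: "finite S" "\<And>p. p \<in> S \<Longrightarrow> prime p"
    and eq: "\<And>p. prime p \<Longrightarrow> p \<notin> S \<Longrightarrow> f p = chi (int p)"
    and F: "dirichlet_term f s sums F" and L: "dirichlet_term (\<lambda>n. chi (int n)) s sums L"
  shows "(\<Prod>p\<in>S. 1 - dirichlet_term f s p) * F = (\<Prod>p\<in>S. 1 - dirichlet_term (\<lambda>n. chi (int n)) s p) * L"
proof (rule sums_unique2)
  have mult: "dirichlet_term f s (m * n) = dirichlet_term f s m * dirichlet_term f s n" for m n
  proof (cases "m = 0 \<or> n = 0")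
    case False
    then show ?thesis using f by (simp add: dirichlet_term_def completely_multiplicative_def powr_mult)
  qed auto
  show "(\<lambda>n. if \<exists>p\<in>S. p dvd n then 0 else dirichlet_term f s n) sums ((\<Prod>p\<in>S. 1 - dirichlet_term f s p) * F)"
    by (rule sums_sieve[OF F S mult])
  have "(\<lambda>n. if \<exists>p\<in>S. p dvd n then 0 else dirichlet_term f s n)
    = (\<lambda>n. if \<exists>p\<in>S. p dvd n then 0 else dirichlet_term (\<lambda>n. chi (int n)) s n)"
  proof
    fix n
    show "(if \<exists>p\<in>S. p dvd n then 0 else dirichlet_term f s n)
      = (if \<exists>p\<in>S. p dvd n then 0 else dirichlet_term (\<lambda>n. chi (int n)) s n)"
      using completely_multiplicative_prime_eq[where n = n and S = S, OF f D eq] by (cases "n = 0") (auto simp: dirichlet_term_def)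
  qed
  moreover have "(\<lambda>n. if \<exists>p\<in>S. p dvd n then 0 else dirichlet_term (\<lambda>n. chi (int n)) s n)
    sums ((\<Prod>p\<in>S. 1 - dirichlet_term (\<lambda>n. chi (int n)) s p) * L)"
    by (rule sums_sieve[OF L S dirichlet_term_mult]) (simp_all add: dirichlet_character_mult[OF D])
  ultimately show "(\<lambda>n. if \<exists>p\<in>S. p dvd n then 0 else dirichlet_term f s n)
    sums ((\<Prod>p\<in>S. 1 - dirichlet_term (\<lambda>n. chi (int n)) s p) * L)" by simp
qed

lemma euler_factors_order_at_0:
  fixes g :: "nat \<Rightarrow> complex"
  assumes S: "finite S" "\<And>p. p \<in> S \<Longrightarrow> prime p"
  obtains l where "l \<noteq> 0"
    "((\<lambda>s. (\<Prod>p\<in>S. 1 - dirichlet_term g s p) / of_real s ^ card {p \<in> S. g p = 1}) \<longlongrightarrow> l) (at_right 0)"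
proof -
  define e where "e p = (if g p = 1 then 1 else 0 :: nat)" for p
  \<comment> \<open>ln p is the derivative of 1 - p^-s at 0, nonzero because p > 1; a factor with
    \<open>g p\<close> different from 1 simply tends to 1 - g(p).\<close>
  define l where "l p = (if g p = 1 then of_real (ln (real p)) else 1 - g p)" for p
  have lim: "((\<lambda>s. (1 - dirichlet_term g s p) / of_real s ^ e p) \<longlongrightarrow> l p) (at_right 0)" if p: "p \<in> S" for p
  proof (cases "g p = 1")
    case True
    have "real p > 0" using prime_gt_0_nat[OF S(2)[OF p]] by simp
    from tendsto_minus[OF powr_minus_1_div_tendsto[OF this]]
    have "((\<lambda>s. - ((real p powr - s - 1) / s)) \<longlongrightarrow> ln (real p)) (at_right 0)"
      by (simp only: minus_minus)
    then have "((\<lambda>s. complex_of_real (- ((real p powr - s - 1) / s))) \<longlongrightarrow> of_real (ln (real p))) (at_right 0)"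
      by (rule tendsto_of_real)
    moreover have "complex_of_real (- ((real p powr - s - 1) / s)) = (1 - dirichlet_term g s p) / of_real s ^ e p" for s
      using True by (simp add: dirichlet_term_def e_def minus_divide_left)
    ultimately show ?thesis by (simp only: l_def True simp_thms if_True)
  next
    case False
    have "((\<lambda>s. 1 - g p * complex_of_real (real p powr - s)) \<longlongrightarrow> 1 - g p * of_real (real p powr - 0)) (at_right 0)"
      using prime_gt_0_nat[OF S(2)[OF p]] by (intro tendsto_intros) auto
    then show ?thesis
      using False prime_gt_0_nat[OF S(2)[OF p]] by (simp add: l_def e_def dirichlet_term_def)
  qed
  have "(\<Sum>p\<in>S. e p) = card {p \<in> S. g p = 1}"
    using S(1) by (simp add: e_def sum.If_cases Int_def)
  then have "(\<Prod>p\<in>S. (1 - dirichlet_term g s p) / of_real s ^ e p)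
    = (\<Prod>p\<in>S. 1 - dirichlet_term g s p) / of_real s ^ card {p \<in> S. g p = 1}" for s
    by (simp add: prod_dividef power_sum [symmetric])
  moreover have "((\<lambda>s. \<Prod>p\<in>S. (1 - dirichlet_term g s p) / of_real s ^ e p) \<longlongrightarrow> (\<Prod>p\<in>S. l p)) (at_right 0)"
    by (rule tendsto_prod) (rule lim)
  ultimately have "((\<lambda>s. (\<Prod>p\<in>S. 1 - dirichlet_term g s p) / of_real s ^ card {p \<in> S. g p = 1}) \<longlongrightarrow> (\<Prod>p\<in>S. l p)) (at_right 0)"
    by (simp only:)
  moreover have "(\<Prod>p\<in>S. l p) \<noteq> 0"
  proof -
    have "l p \<noteq> 0" if "p \<in> S" for p
      using prime_gt_1_nat[OF S(2)[OF that]] by (auto simp: l_def)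
    then show ?thesis using S(1) by simp
  qed
  ultimately show thesis by (rule that[rotated])
qed

section \<open>Dirichlet series with small partial sums\<close>

lemma ln_power_le_powr:
  assumes s: "s > 0" and x: "x \<ge> 1" and N: "N > 0"
  shows "ln x ^ N \<le> (2 * real N / s) ^ N * x powr (s / 2)"
proof -
  \<comment> \<open>The inequality ln y <= y is used at y = x^r, with \<open>r\<close> such that the
    N-th power costs only half of the exponent \<open>s\<close>; the other half remains for
    convergence.\<close>
  define r where "r = s / (2 * real N)"
  have r: "r > 0" using s N by (simp add: r_def)
  have "r * ln x = ln (x powr r)" using x by (simp add: ln_powr)
  also have "\<dots> \<le> x powr r" using ln_le_minus_one[of "x powr r"] x by simp
  finally have "ln x \<le> (1 / r) * x powr r" using r by (simp add: field_simps)
  then have "ln x ^ N \<le> ((1 / r) * x powr r) ^ N" using x by (intro power_mono) auto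
  also have "\<dots> = (1 / r) ^ N * x powr (s / 2)"
  proof -
    have "(x powr r) ^ N = x powr (s / 2)"
      using x N by (simp add: powr_power r_def)
    then show ?thesis by (simp add: power_mult_distrib power_divide)
  qed
  finally show ?thesis by (simp add: r_def)
qed

text \<open>The bound for the power of the logarithm costs (2N/s)^N, which the factor s^N cancels;
  the 3 bounds s (1 + 2/s) = s + 2. Thus \<open>K\<close> ends up multiplied by
  \<open>s ^ N\<close>, harmless as s -> 0, and \<epsilon> by a constant depending on
  \<open>N\<close> alone.\<close>

lemma dirichlet_series_small_partial_sums:
  fixes f :: "nat \<Rightarrow> complex"
  assumes N: "N > 0" and s: "0 < s" "s \<le> 1" and K: "K \<ge> 0" and \<epsilon>: "\<epsilon> \<ge> 0"
    and A: "\<And>n. norm (\<Sum>k<Suc n. f (Suc k)) \<le> K + \<epsilon> * ln (real (Suc n)) ^ N"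
  shows "dirichlet_term f s sums dirichlet_series f s"
    and "s ^ N * norm (dirichlet_series f s) \<le> K * s ^ N + 3 * (2 * real N) ^ N * \<epsilon>"
proof -
  define c where "c = \<epsilon> * (2 * real N / s) ^ N"
  have c: "c \<ge> 0" using s \<epsilon> by (simp add: c_def)
  have A': "norm (\<Sum>k<Suc n. f (Suc k)) \<le> K + c * real (Suc n) powr (s / 2)" for n
  proof -
    have "\<epsilon> * ln (real (Suc n)) ^ N \<le> \<epsilon> * ((2 * real N / s) ^ N * real (Suc n) powr (s / 2))"
      using ln_power_le_powr[OF s(1) _ N, of "real (Suc n)"] \<epsilon> by (intro mult_left_mono) auto
    then show ?thesis using A[of n] by (simp add: c_def mult.assoc)
  qed
  define w where "w k = real (Suc k) powr - s" for k
  have d: "0 \<le> w k - w (Suc k)" "w k - w (Suc k) \<le> s * real (Suc k) powr (- s - 1)" for k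
    using powr_neg_diff_bounds[OF s(1), of k] powr_neg_decseq[of s] s by (auto simp: w_def decseq_Suc_iff)
  define t where "t k = (\<Sum>j\<le>k. f (Suc j)) * of_real (w k - w (Suc k))" for k
  define b where "b k = K * (w k - w (Suc k)) + c * s * real (Suc k) powr (- (s / 2) - 1)" for k
  have tb: "norm (t k) \<le> b k" for k
  proof -
    have "norm (t k) \<le> (K + c * real (Suc k) powr (s / 2)) * (w k - w (Suc k))"
      unfolding t_def norm_mult norm_of_real using A'[of k] d[of k]
      by (simp add: lessThan_Suc_atMost mult_right_mono del: of_nat_Suc)
    also have "\<dots> \<le> K * (w k - w (Suc k)) + c * real (Suc k) powr (s / 2) * (s * real (Suc k) powr (- s - 1))"
      unfolding distrib_right using d[of k] c by (intro add_left_mono mult_left_mono) auto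
    also have "c * real (Suc k) powr (s / 2) * (s * real (Suc k) powr (- s - 1))
      = c * s * (real (Suc k) powr (s / 2) * real (Suc k) powr (- s - 1))"
      by (simp only: mult_ac)
    also have "real (Suc k) powr (s / 2) * real (Suc k) powr (- s - 1) = real (Suc k) powr (- (s / 2) - 1)"
      unfolding powr_add [symmetric] by simp
    finally show ?thesis by (simp only: b_def)
  qed
  have tel: "(\<lambda>k. w k - w (Suc k)) sums 1"
    using telescope_sums'[OF powr_neg_tendsto_0[OF s(1)]] by (simp add: w_def)
  have s2: "s / 2 > 0" using s by simp
  note P = summable_powr_neg[OF s2]
  have bs: "b sums (K * 1 + c * s * (\<Sum>k. real (Suc k) powr (- (s / 2) - 1)))"
    unfolding b_def by (intro sums_add sums_mult tel summable_sums P)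
  have st: "summable t"
    by (rule summable_comparison_test'[OF sums_summable[OF bs], where N = 0]) (rule tb)
  have "(\<lambda>n. (\<Sum>k<Suc n. f (Suc k)) * of_real (w (Suc n))) \<longlonglongrightarrow> 0"
  proof (rule Lim_null_comparison)
    show "\<forall>\<^sub>F n in sequentially. norm ((\<Sum>k<Suc n. f (Suc k)) * of_real (w (Suc n)))
      \<le> K * real (Suc n) powr - s + c * real (Suc n) powr - (s / 2)"
    proof (rule always_eventually, rule allI)
      fix n
      have "w (Suc n) \<le> w n" "0 \<le> w (Suc n)" using d[of n] by (simp_all add: w_def)
      then have "norm ((\<Sum>k<Suc n. f (Suc k)) * of_real (w (Suc n))) \<le> (K + c * real (Suc n) powr (s / 2)) * w n"
        unfolding norm_mult norm_of_real using A'[of n] K c by (intro mult_mono) auto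
      also have "\<dots> = K * real (Suc n) powr - s + c * (real (Suc n) powr (s / 2) * real (Suc n) powr - s)"
        by (simp only: w_def distrib_right mult.assoc)
      also have "real (Suc n) powr (s / 2) * real (Suc n) powr - s = real (Suc n) powr - (s / 2)"
        unfolding powr_add [symmetric] by simp
      finally show "norm ((\<Sum>k<Suc n. f (Suc k)) * of_real (w (Suc n)))
        \<le> K * real (Suc n) powr - s + c * real (Suc n) powr - (s / 2)" .
    qed
    have "(\<lambda>n. K * real (Suc n) powr - s + c * real (Suc n) powr - (s / 2)) \<longlonglongrightarrow> K * 0 + c * 0"
      by (intro tendsto_add tendsto_mult_left powr_neg_tendsto_0 s s2)
    then show "(\<lambda>n. K * real (Suc n) powr - s + c * real (Suc n) powr - (s / 2)) \<longlonglongrightarrow> 0" by simp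
  qed
  then have "(\<lambda>n. (\<Sum>k<n. f (Suc k)) * of_real (w n)) \<longlonglongrightarrow> 0"
    by (rule LIMSEQ_imp_Suc)
  then have "(\<lambda>k. f (Suc k) * of_real (w k)) sums suminf t"
    by (rule abel_sums) (use summable_sums[OF st] in \<open>simp add: t_def [abs_def]\<close>)
  then have S: "(\<lambda>k. dirichlet_term f s (Suc k)) sums suminf t"
    by (simp only: dirichlet_term_def w_def)
  then have E: "dirichlet_series f s = suminf t"
    unfolding dirichlet_series_def by (rule sums_unique[symmetric])
  show "dirichlet_term f s sums dirichlet_series f s"
    using S unfolding E sums_dirichlet_term_Suc_iff .
  have "norm (dirichlet_series f s) \<le> suminf b"
    unfolding E by (rule norm_suminf_le[OF tb sums_summable[OF bs]])
  also have "\<dots> = K + c * s * (\<Sum>k. real (Suc k) powr (- (s / 2) - 1))"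
    using sums_unique[OF bs] by simp
  also have "\<dots> \<le> K + c * s * (1 + 1 / (s / 2))"
    using P(2) c s by (intro add_left_mono mult_left_mono) auto
  also have "c * s * (1 + 1 / (s / 2)) = c * (s + 2)"
    using s by (simp add: field_simps)
  also have "\<dots> \<le> c * 3" using c s by (intro mult_left_mono) auto
  finally have "s ^ N * norm (dirichlet_series f s) \<le> s ^ N * (K + c * 3)"
    using s by (intro mult_left_mono) auto
  also have "\<dots> = K * s ^ N + 3 * (2 * real N) ^ N * \<epsilon>"
    using s by (simp add: c_def power_divide field_simps)
  finally show "s ^ N * norm (dirichlet_series f s) \<le> K * s ^ N + 3 * (2 * real N) ^ N * \<epsilon>" .
qed

lemma dirichlet_series_tendsto_0_of_small_partial_sums:
  fixes f :: "nat \<Rightarrow> complex"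
  assumes N: "N > 0"
    and small: "\<And>\<epsilon>. \<epsilon> > 0 \<Longrightarrow> \<forall>\<^sub>F n in sequentially. norm (\<Sum>k<n. f (Suc k)) \<le> \<epsilon> * ln (real n) ^ N"
  shows "\<And>s. 0 < s \<Longrightarrow> s \<le> 1 \<Longrightarrow> dirichlet_term f s sums dirichlet_series f s"
    and "((\<lambda>s. of_real s ^ N * dirichlet_series f s) \<longlongrightarrow> 0) (at_right 0)"
proof -
  have ex: "\<exists>K\<ge>0. \<forall>n. norm (\<Sum>k<Suc n. f (Suc k)) \<le> K + \<epsilon> * ln (real (Suc n)) ^ N" if \<epsilon>: "\<epsilon> > 0" for \<epsilon>
  proof -
    obtain m where m: "\<And>n. n \<ge> m \<Longrightarrow> norm (\<Sum>k<n. f (Suc k)) \<le> \<epsilon> * ln (real n) ^ N"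
      using small[OF \<epsilon>] by (auto simp: eventually_sequentially)
    \<comment> \<open>\<open>K\<close> absorbs the finitely many partial sums before the asymptotic
      bound sets in. It may depend on \<epsilon>, since for fixed \<epsilon> the term
      \<open>K * s ^ N\<close> tends to 0.\<close>
    define K where "K = (\<Sum>n<m. norm (\<Sum>k<n. f (Suc k)))"
    have K: "K \<ge> 0" unfolding K_def by (intro sum_nonneg) auto
    have "norm (\<Sum>k<Suc n. f (Suc k)) \<le> K + \<epsilon> * ln (real (Suc n)) ^ N" for n
    proof (cases "Suc n \<ge> m")
      case True
      then show ?thesis using m[OF True] K by linarith
    next
      case False
      then have "norm (\<Sum>k<Suc n. f (Suc k)) \<le> K"
        unfolding K_def by (intro member_le_sum[where f = "\<lambda>n. norm (\<Sum>k<n. f (Suc k))"]) auto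
      moreover have "0 \<le> \<epsilon> * ln (real (Suc n)) ^ N" using \<epsilon> by simp
      ultimately show ?thesis by linarith
    qed
    with K show ?thesis by blast
  qed
  show "dirichlet_term f s sums dirichlet_series f s" if s: "0 < s" "s \<le> 1" for s
  proof -
    obtain K where K: "K \<ge> 0" "\<And>n. norm (\<Sum>k<Suc n. f (Suc k)) \<le> K + 1 * ln (real (Suc n)) ^ N"
      using ex[of 1] by auto
    show ?thesis by (rule dirichlet_series_small_partial_sums(1)[OF N s K(1) _ K(2)]) simp
  qed
  show "((\<lambda>s. of_real s ^ N * dirichlet_series f s) \<longlongrightarrow> 0) (at_right 0)"
  proof (rule tendstoI)
    fix e :: real assume e: "e > 0"
    define C where "C = 3 * (2 * real N) ^ N"
    have C: "C > 0" using N by (simp add: C_def)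
    define \<epsilon> where "\<epsilon> = e / (2 * C)"
    have \<epsilon>: "\<epsilon> > 0" "C * \<epsilon> = e / 2" using C e by (simp_all add: \<epsilon>_def)
    obtain K where K: "K \<ge> 0" "\<And>n. norm (\<Sum>k<Suc n. f (Suc k)) \<le> K + \<epsilon> * ln (real (Suc n)) ^ N"
      using ex[OF \<epsilon>(1)] by auto
    have "((\<lambda>s. K * s ^ N) \<longlongrightarrow> K * 0 ^ N) (at_right 0)" by (intro tendsto_intros)
    moreover have "K * 0 ^ N = 0" using N by simp
    ultimately have "((\<lambda>s. K * s ^ N) \<longlongrightarrow> 0) (at_right 0)" by (simp only:)
    then have "\<forall>\<^sub>F s in at_right 0. K * s ^ N < e / 2"
      using e by (intro order_tendstoD(2)) auto
    moreover have "\<forall>\<^sub>F s::real in at_right 0. 0 < s \<and> s \<le> 1"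
      by (auto simp: eventually_at_right_field intro!: exI[of _ 1])
    ultimately show "\<forall>\<^sub>F s in at_right 0. dist (of_real s ^ N * dirichlet_series f s) 0 < e"
    proof eventually_elim
      case (elim s)
      have "s ^ N * norm (dirichlet_series f s) \<le> K * s ^ N + C * \<epsilon>"
        unfolding C_def by (rule dirichlet_series_small_partial_sums(2)[OF N _ _ K(1) _ K(2)]) (use elim \<epsilon> in auto)
      then show ?case using elim \<epsilon>(2) by (simp add: norm_mult norm_power)
    qed
  qed
qed

lemma not_omega_limsupD:
  assumes "\<not> omega_limsup g h" and \<epsilon>: "\<epsilon> > 0"
  shows "\<forall>\<^sub>F x in at_top. norm (g x) / \<bar>h x\<bar> < \<epsilon>"
proof -
  have "Limsup at_top (\<lambda>x. ereal (norm (g x) / \<bar>h x\<bar>)) < ereal \<epsilon>"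
    using assms by (auto simp: omega_limsup_def not_less intro: le_less_trans)
  then show ?thesis
    using Limsup_lessD by fastforce
qed

lemma sum_upto_real_of_nat:
  "(\<Sum>k | 1 \<le> k \<and> real k \<le> real n. f k) = (\<Sum>k<n. f (Suc k))"
  by (rule sum.reindex_bij_witness[of _ Suc "\<lambda>n. n - 1"]) auto

theorem theorem1:
  fixes q :: nat and chi :: "int \<Rightarrow> complex" and f :: "nat \<Rightarrow> complex"
    and S :: "nat set" and T :: int and N :: nat
  assumes "primitive_dirichlet_character q chi"
    and "completely_multiplicative f"
    and "finite S" and "\<forall>p\<in>S. prime p"
    and "\<forall>p. prime p \<and> p \<notin> S \<longrightarrow> f p = chi (int p)"
    and "\<forall>p\<in>S. norm (f p) = 1"
    and "T = int (card {p \<in> S. f p = 1}) - int (card {p \<in> S. chi (int p) = 1})"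
    and "chi (-1) = -1 \<Longrightarrow> int N = max 0 T"
    and "chi (-1) = 1 \<Longrightarrow> int N = max 0 (T - 1)"
  shows "omega_limsup (\<lambda>x. \<Sum>n | 1 \<le> n \<and> real n \<le> x. f n) (\<lambda>x. ln x ^ N)"
proof (rule ccontr)
  assume "\<not> ?thesis"
  note small = not_omega_limsupD[OF this]
  have D: "dirichlet_character q chi"
    using assms(1) by (simp add: primitive_dirichlet_character_def)
  have q0: "q > 0" using D by (simp add: dirichlet_character_def)
  have small': "\<forall>\<^sub>F n in sequentially. norm (\<Sum>k<n. f (Suc k)) \<le> \<epsilon> * ln (real n) ^ N" if \<epsilon>: "\<epsilon> > 0" for \<epsilon>
  proof -
    have "\<forall>\<^sub>F n in sequentially. norm (\<Sum>k<n. f (Suc k)) / \<bar>ln (real n) ^ N\<bar> < \<epsilon>"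
      using eventually_compose_filterlim[OF small[OF \<epsilon>] filterlim_real_sequentially]
      unfolding sum_upto_real_of_nat .
    then show ?thesis
      using eventually_gt_at_top[of 1]
    proof eventually_elim
      case (elim n)
      have "ln (real n) ^ N > 0" using elim(2) by simp
      then show ?case using elim(1) by (simp add: divide_less_eq)
    qed
  qed
  show False
  proof (cases "N = 0")
    case True
    have "infinite ({p. prime p} - (S \<union> {..q}))"
      using primes_infinite assms(3) by (simp add: Diff_infinite_finite)
    then obtain p where p: "prime p" "p \<notin> S" "p > q"
      using infinite_imp_nonempty by (metis (no_types, lifting) DiffE Un_iff all_not_in_conv atMost_iff mem_Collect_eq not_le)
    have "\<not> p dvd q" using p(3) q0 by (auto dest: dvd_imp_le)
    then have "coprime (int p) (int q)" using p(1) by (simp add: prime_imp_coprime)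
    then have fp: "norm (f p) = 1" using assms(5) p norm_dirichlet_character[OF D] by simp
    have fpk: "norm (f (p ^ k)) = 1" for k
    proof (induction k)
      case 0 then show ?case using assms(2) by (simp add: completely_multiplicative_def)
    next
      case (Suc k)
      have "f (p * p ^ k) = f p * f (p ^ k)"
        using assms(2) prime_gt_0_nat[OF p(1)] by (simp add: completely_multiplicative_def)
      then show ?case using Suc fp by (simp add: norm_mult)
    qed
    \<comment> \<open>Two consecutive partial sums of norm at most 1/3 differ by less than 1, the
      modulus of \<open>f\<close> at \<open>p ^ Suc m\<close>; the index is taken one below that
      power so that both lie beyond \<open>m\<close>.\<close>
    obtain m where m: "\<And>n. n \<ge> m \<Longrightarrow> norm (\<Sum>k<n. f (Suc k)) \<le> 1 / 3"
      using small'[of "1 / 3"] True by (auto simp: eventually_sequentially)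
    define n where "n = p ^ Suc m - 1"
    have "p ^ Suc m > Suc m" using power_gt_expt[of p "Suc m"] prime_gt_1_nat[OF p(1)] by simp
    then have n: "Suc n = p ^ Suc m" "n \<ge> m" by (auto simp: n_def)
    have "f (Suc n) = (\<Sum>k<Suc n. f (Suc k)) - (\<Sum>k<n. f (Suc k))" by simp
    also have "norm \<dots> \<le> norm (\<Sum>k<Suc n. f (Suc k)) + norm (\<Sum>k<n. f (Suc k))"
      by (rule norm_triangle_ineq4)
    also have "\<dots> \<le> 1 / 3 + 1 / 3"
      using n(2) by (intro add_mono m) auto
    finally show False using fpk[of "Suc m"] n(1) by simp
  next
    case False
    then have N: "N > 0" by simp
    define \<alpha> where "\<alpha> = card {p \<in> S. f p = 1}"
    define \<beta> where "\<beta> = card {p \<in> S. chi (int p) = 1}"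
    have T: "T = int \<alpha> - int \<beta>" using assms(7) by (simp add: \<alpha>_def \<beta>_def)
    \<comment> \<open>As \<open>N > 0\<close>, the maximum is not attained at 0, so \<open>T\<close>
      is exactly \<open>N\<close> for odd and \<open>N + 1\<close> for even
      \<open>chi\<close>.\<close>
    have parity: "chi (-1) = -1 \<and> \<alpha> = N + \<beta> \<or> chi (-1) = 1 \<and> \<alpha> = Suc (N + \<beta>)"
      using dirichlet_character_minus_1[OF D] assms(8,9) N T by (auto simp: max_def split: if_splits)
    then have "\<alpha> > \<beta>" using N by auto
    \<comment> \<open>For the constant character every prime of \<open>S\<close> is counted in
      \<beta>, so \<alpha> could not exceed it.\<close>
    have q: "q > 1"
    proof (rule ccontr)
      assume "\<not> q > 1"
      then have "q = 1" using q0 by simp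
      then have "chi (int p) = 1" for p
        using dirichlet_character_cong[OF D, of "int p" 1] dirichlet_character_1[OF D] by (simp add: cong_def)
      then have "\<alpha> \<le> \<beta>"
        unfolding \<alpha>_def \<beta>_def using assms(3) by (auto intro!: card_mono)
      with \<open>\<alpha> > \<beta>\<close> show False by simp
    qed
    obtain c where c: "coprime c (int q)" "chi c \<noteq> 1" using primitive_nonprincipal[OF assms(1) q] .
    obtain B where B: "\<And>n. norm (\<Sum>k<n. chi (int (Suc k))) \<le> B"
      using dirichlet_character_partial_sums(2)[OF D c] by blast
    define F where "F = dirichlet_series f"
    define L where "L = dirichlet_series (\<lambda>n. chi (int n))"
    have Fs: "dirichlet_term f s sums F s" if "0 < s" "s \<le> 1" for s
      unfolding F_def by (rule dirichlet_series_tendsto_0_of_small_partial_sums(1)[OF N small' that])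
    have F0: "((\<lambda>s. of_real s ^ N * F s) \<longlongrightarrow> 0) (at_right 0)"
      unfolding F_def by (rule dirichlet_series_tendsto_0_of_small_partial_sums(2)[OF N small'])
    have Ls: "dirichlet_term (\<lambda>n. chi (int n)) s sums L s" if "0 < s" for s
      using summable_sums[OF summable_dirichlet_term_bounded(1)[of "\<lambda>n. chi (int n)", OF B that]]
      unfolding sums_dirichlet_term_Suc_iff [symmetric] L_def dirichlet_series_def .
    define Pf where "Pf s = (\<Prod>p\<in>S. 1 - dirichlet_term f s p)" for s
    define Pc where "Pc s = (\<Prod>p\<in>S. 1 - dirichlet_term (\<lambda>n. chi (int n)) s p)" for s
    have rel: "Pf s * F s = Pc s * L s" if "0 < s" "s \<le> 1" for s
      unfolding Pf_def Pc_def
      by (rule dirichlet_series_finite_change[OF assms(2) D assms(3) _ _ Fs[OF that] Ls[OF that(1)]])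
        (use assms(4,5) in auto)
    obtain lf where lf: "((\<lambda>s. Pf s / of_real s ^ \<alpha>) \<longlongrightarrow> lf) (at_right 0)"
      using euler_factors_order_at_0[of S f] assms(3,4) unfolding Pf_def \<alpha>_def by blast
    obtain lc where lc: "lc \<noteq> 0" "((\<lambda>s. Pc s / of_real s ^ \<beta>) \<longlongrightarrow> lc) (at_right 0)"
      using euler_factors_order_at_0[of S "\<lambda>n. chi (int n)"] assms(3,4) unfolding Pc_def \<beta>_def by blast
    \<comment> \<open>The order of the L-function at 0: 0 for odd and 1 for even \<open>chi\<close>.
      By \<open>parity\<close> the natural-number subtraction is exact.\<close>
    define d where "d = \<alpha> - (N + \<beta>)"
    obtain l where l: "l \<noteq> 0" "((\<lambda>s. L s / of_real s ^ d) \<longlongrightarrow> l) (at_right 0)" and \<alpha>: "\<alpha> = d + N + \<beta>"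
      using parity
    proof
      assume "chi (-1) = -1 \<and> \<alpha> = N + \<beta>"
      then show ?thesis
        using dirichlet_L_odd_tendsto_at_0[OF assms(1) q] that unfolding L_def d_def by auto
    next
      assume "chi (-1) = 1 \<and> \<alpha> = Suc (N + \<beta>)"
      then show ?thesis
        using dirichlet_L_even_div_tendsto_nonzero_at_0[OF assms(1) q] that unfolding L_def d_def by auto
    qed
    \<comment> \<open>The powers of \<open>s\<close> balance because \<alpha> = d + N + \<beta>: one
      and the same function tends to 0 by the smallness of \<open>F\<close> and to
      \<open>lc * l\<close> by the factorization through \<open>L\<close>.\<close>
    have "((\<lambda>s. (of_real s ^ N * F s) * (Pf s / of_real s ^ \<alpha>)) \<longlongrightarrow> 0 * lf) (at_right 0)"
      by (intro tendsto_mult F0 lf)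
    moreover have "((\<lambda>s. (of_real s ^ N * F s) * (Pf s / of_real s ^ \<alpha>)) \<longlongrightarrow> lc * l) (at_right 0)"
    proof (rule Lim_transform_eventually[OF tendsto_mult[OF lc(2) l(2)]])
      have "(Pc s / of_real s ^ \<beta>) * (L s / of_real s ^ d) = (of_real s ^ N * F s) * (Pf s / of_real s ^ \<alpha>)"
        if "0 < s" "s \<le> 1" for s
      proof -
        have "(of_real s ^ N * F s) * (Pf s / of_real s ^ \<alpha>) = of_real s ^ N * (Pf s * F s) / of_real s ^ \<alpha>"
          by simp
        also have "\<dots> = of_real s ^ N * (Pc s * L s) / of_real s ^ \<alpha>"
          by (simp only: rel[OF that])
        also have "\<dots> = (Pc s / of_real s ^ \<beta>) * (L s / of_real s ^ d)"
          using that by (simp add: \<alpha> power_add)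
        finally show ?thesis by simp
      qed
      then show "\<forall>\<^sub>F s in at_right 0. (Pc s / of_real s ^ \<beta>) * (L s / of_real s ^ d)
        = (of_real s ^ N * F s) * (Pf s / of_real s ^ \<alpha>)"
        by (auto simp: eventually_at_right_field intro!: exI[of _ 1])
    qed
    ultimately have "0 * lf = lc * l"
      by (intro tendsto_unique[of "at_right (0::real)"]) auto
    with lc(1) l(1) show False by simp
  qed
qed

end
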